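(* Let $R$ be a complete Noetherian local ring and let $A\subseteq B$ be Matlis-dualizable $R$-modules. Let $\mathrm i$ be an interior operation (on a class $\mathcal M$ of Matlis-dualizable $R$-modules closed under submodules and quotients and containing $B$), let $\alpha:=\mathrm i^{\smile}$, and let $\mathrm{cl}$ be the corresponding residual closure operation. There exists an order-reversing one-to-one correspondence between the poset of $\mathrm i$-expansions of $A$ in $B$ and the poset of $\mathrm{cl}$-reductions of $(B/A)^\vee$ in $B^\vee$. Under this correspondence, an $\mathrm i$-expansion $C$ of $A$ in $B$ maps to $(B/C)^\vee$, a $\mathrm{cl}$-reduction of $(B/A)^\vee$ in $B^\vee$.
   Context: $(-)^\vee=\mathrm{Hom}_R(-,E)$ with $E$ the injective hull of the residue field. A module $M$ is Matlis-dualizable if the natural map $M\to M^{\vee\vee}$ is an isomorphism. For $C\subseteq B$, $(B/C)^\vee$ is regarded as the submodule of $B^\vee$ of maps killing $C$. A submodule selector assigns to each module $M$ of a class a submodule $\alpha(M)\subseteq M$, compatibly with isomorphisms. An interior operation is a submodule selector $\mathrm i$ with $L\subseteq M\Rightarrow\mathrm i(L)\subseteq\mathrm i(M)$ and $\mathrm i(\mathrm i(M))=\mathrm i(M)$. The dual $\alpha=\mathrm i^{\smile}$ is the submodule selector on $\mathcal M^\vee=\{M^\vee:M\in\mathcal M\}$ (up to isomorphism) given by $\alpha(N)=(N^\vee/\mathrm i(N^\vee))^\vee\subseteq N^{\vee\vee}\cong N$. The corresponding residual closure operation on $\mathcal M^\vee$ is given, for $L\subseteq M$ in $\mathcal M^\vee$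 with quotient map $\pi:M\to M/L$, by $L^{\mathrm{cl}}_M=\pi^{-1}(\alpha(M/L))$. For $A\subseteq C\subseteq B$, $C$ is an $\mathrm i$-expansion of $A$ in $B$ if $\mathrm i(A)=\mathrm i(C)$. For $L\subseteq N\subseteq M$, $L$ is a $\mathrm{cl}$-reduction of $N$ in $M$ if $L^{\mathrm{cl}}_M=N^{\mathrm{cl}}_M$. Both posets are ordered by inclusion. *)

theory Defs
  imports "HOL-Algebra.Module" "HOL-Algebra.Ideal_Product" "HOL-Algebra.Ring_Divisibility"
begin

section \<open>Modules, homomorphisms, submodules and quotients\<close>

text \<open>Records of type \<open>('r, 'm) module\<close> carry the unused ring fields \<open>mult\<close> and \<open>one\<close>; nothing below
  depends on them, and the constructions set them to \<open>undefined\<close>.\<close>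

definition mod_hom ::
    "('r, 's) ring_scheme \<Rightarrow> ('r, 'm) module \<Rightarrow> ('r, 'n) module \<Rightarrow> ('m \<Rightarrow> 'n) set" where
  "mod_hom R M N = {f \<in> carrier M \<rightarrow> carrier N.
     (\<forall>x \<in> carrier M. \<forall>y \<in> carrier M. f (x \<oplus>\<^bsub>M\<^esub> y) = f x \<oplus>\<^bsub>N\<^esub> f y) \<and>
     (\<forall>r \<in> carrier R. \<forall>x \<in> carrier M. f (r \<odot>\<^bsub>M\<^esub> x) = r \<odot>\<^bsub>N\<^esub> f x)}"

definition mod_iso ::
    "('r, 's) ring_scheme \<Rightarrow> ('r, 'm) module \<Rightarrow> ('r, 'n) module \<Rightarrow> ('m \<Rightarrow> 'n) set" where
  "mod_iso R M N = {f \<in> mod_hom R M N. bij_betw f (carrier M) (carrier N)}"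

abbreviation sub_mod :: "('r, 'm) module \<Rightarrow> 'm set \<Rightarrow> ('r, 'm) module" where
  "sub_mod M L \<equiv> M\<lparr>carrier := L\<rparr>"

definition quot_mod :: "('r, 'm) module \<Rightarrow> 'm set \<Rightarrow> ('r, 'm set) module" where
  "quot_mod M L =
     \<lparr>carrier = a_rcosets\<^bsub>M\<^esub> L, monoid.mult = undefined, one = undefined,
      zero = L, add = set_add M, smult = (\<lambda>r U. (\<Union>x \<in> U. L +>\<^bsub>M\<^esub> (r \<odot>\<^bsub>M\<^esub> x)))\<rparr>"

definition self_mod :: "('r, 's) ring_scheme \<Rightarrow> ('r, 'r) module" where
  "self_mod R =
     \<lparr>carrier = carrier R, monoid.mult = monoid.mult R, one = one R, zero = zero R, add = add R, smult = monoid.mult R\<rparr>"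


section \<open>Complete Noetherian local rings\<close>

definition local_ring :: "('r, 's) ring_scheme \<Rightarrow> bool" where
  "local_ring R \<longleftrightarrow> cring R \<and> (\<exists>!m. maximalideal m R)"

definition max_ideal :: "('r, 's) ring_scheme \<Rightarrow> 'r set" where
  "max_ideal R = (THE m. maximalideal m R)"

text \<open>The two conjuncts are injectivity and surjectivity of \<open>R \<rightarrow> lim R/I\<^sup>n\<close>; a sequence \<open>x\<close> with
  \<open>x (n + 1) - x n \<in> I\<^sup>n\<close> represents an element of the inverse limit. Powers are taken in the
  library's monoid of ideals.\<close>

definition adically_complete :: "('r, 's) ring_scheme \<Rightarrow> 'r set \<Rightarrow> bool" where
  "adically_complete R I \<longleftrightarrow>
     (\<Inter>n::nat. I [^]\<^bsub>ideals_set R\<^esub> n) = {\<zero>\<^bsub>R\<^esub>} \<and>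
     (\<forall>x :: nat \<Rightarrow> 'r. (\<forall>n. x n \<in> carrier R) \<and> (\<forall>n. x (Suc n) \<ominus>\<^bsub>R\<^esub> x n \<in> I [^]\<^bsub>ideals_set R\<^esub> n) \<longrightarrow>
        (\<exists>y \<in> carrier R. \<forall>n. y \<ominus>\<^bsub>R\<^esub> x n \<in> I [^]\<^bsub>ideals_set R\<^esub> n))"

definition complete_noetherian_local_ring :: "('r, 's) ring_scheme \<Rightarrow> bool" where
  "complete_noetherian_local_ring R \<longleftrightarrow>
     local_ring R \<and> noetherian_ring R \<and> adically_complete R (max_ideal R)"

definition residue_field_mod :: "('r, 's) ring_scheme \<Rightarrow> ('r, 'r set) module" where
  "residue_field_mod R = quot_mod (self_mod R) (max_ideal R)"


section \<open>Injective hulls\<close>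

text \<open>A definition cannot quantify over types, so the test modules \<open>Y\<close> range over the modules whose
  elements are taken from the type of the elements of \<open>R\<close>. These include \<open>R\<close> itself with its ideals
  as submodules, so by Baer's criterion extension against them gives extension against modules
  over every type.\<close>

definition injective_mod :: "('r, 's) ring_scheme \<Rightarrow> ('r, 'e) module \<Rightarrow> bool" where
  "injective_mod R E \<longleftrightarrow> module R E \<and>
     (\<forall>(Y :: ('r, 'r) module) Z. module R Y \<and> submodule Z R Y \<longrightarrow>
        (\<forall>f \<in> mod_hom R (sub_mod Y Z) E. \<exists>g \<in> mod_hom R Y E. \<forall>z \<in> Z. g z = f z))"

definition injective_hull :: "('r, 's) ring_scheme \<Rightarrow> ('r, 'k) module \<Rightarrow> ('r, 'e) module \<Rightarrow> bool" where
  "injective_hull R K E \<longleftrightarrow> injective_mod R E \<and>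
     (\<exists>\<iota> \<in> mod_hom R K E. inj_on \<iota> (carrier K) \<and>
        (\<forall>H. submodule H R E \<and> H \<noteq> {\<zero>\<^bsub>E\<^esub>} \<longrightarrow> H \<inter> \<iota> ` carrier K \<noteq> {\<zero>\<^bsub>E\<^esub>}))"


section \<open>Matlis duality\<close>

text \<open>The elements of the dual are extensional functions (\<open>undefined\<close> outside \<open>carrier M\<close>), so that
  homomorphisms agreeing on \<open>carrier M\<close> are equal.\<close>

definition dual_mod ::
    "('r, 's) ring_scheme \<Rightarrow> ('r, 'e) module \<Rightarrow> ('r, 'm) module \<Rightarrow> ('r, 'm \<Rightarrow> 'e) module" where
  "dual_mod R E M =
     \<lparr>carrier = mod_hom R M E \<inter> extensional (carrier M), monoid.mult = undefined, one = undefined,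
      zero = (\<lambda>x \<in> carrier M. \<zero>\<^bsub>E\<^esub>),
      add = (\<lambda>f g. \<lambda>x \<in> carrier M. f x \<oplus>\<^bsub>E\<^esub> g x),
      smult = (\<lambda>r f. \<lambda>x \<in> carrier M. r \<odot>\<^bsub>E\<^esub> f x)\<rparr>"

definition dual_eval ::
    "('r, 's) ring_scheme \<Rightarrow> ('r, 'e) module \<Rightarrow> ('r, 'm) module \<Rightarrow> 'm \<Rightarrow> ('m \<Rightarrow> 'e) \<Rightarrow> 'e" where
  "dual_eval R E M x = (\<lambda>f \<in> carrier (dual_mod R E M). f x)"

definition matlis_dualizable ::
    "('r, 's) ring_scheme \<Rightarrow> ('r, 'e) module \<Rightarrow> ('r, 'm) module \<Rightarrow> bool" where
  "matlis_dualizable R E M \<longleftrightarrow> module R M \<and>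
     dual_eval R E M \<in> mod_iso R M (dual_mod R E (dual_mod R E M))"

text \<open>\<open>(B/C)\<^sup>\<or>\<close> as a submodule of \<open>B\<^sup>\<or>\<close>.\<close>

definition quot_dual ::
    "('r, 's) ring_scheme \<Rightarrow> ('r, 'e) module \<Rightarrow> ('r, 'm) module \<Rightarrow> 'm set \<Rightarrow> ('m \<Rightarrow> 'e) set" where
  "quot_dual R E B C = {f \<in> carrier (dual_mod R E B). \<forall>c \<in> C. f c = \<zero>\<^bsub>E\<^esub>}"


section \<open>Submodule selectors, interior operations and their duals\<close>

text \<open>A class of modules is represented by the set of its members whose elements have a fixed type
  \<open>'m\<close>. The quotient modules of \<open>quot_mod\<close> live on \<open>'m set\<close>, so closure under quotients asks for an
  isomorphic copy in the class; such a copy on \<open>'m\<close> is obtained by choosing coset representatives.\<close>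

definition closed_under_submodules :: "('r, 's) ring_scheme \<Rightarrow> ('r, 'm) module set \<Rightarrow> bool" where
  "closed_under_submodules R \<M> \<longleftrightarrow> (\<forall>M \<in> \<M>. \<forall>L. submodule L R M \<longrightarrow> sub_mod M L \<in> \<M>)"

definition closed_under_quotients :: "('r, 's) ring_scheme \<Rightarrow> ('r, 'm) module set \<Rightarrow> bool" where
  "closed_under_quotients R \<M> \<longleftrightarrow>
     (\<forall>M \<in> \<M>. \<forall>L. submodule L R M \<longrightarrow> (\<exists>Q \<in> \<M>. mod_iso R (quot_mod M L) Q \<noteq> {}))"

definition submodule_selector ::
    "('r, 's) ring_scheme \<Rightarrow> ('r, 'm) module set \<Rightarrow> (('r, 'm) module \<Rightarrow> 'm set) \<Rightarrow> bool" where
  "submodule_selector R \<M> \<alpha> \<longleftrightarrow>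
     (\<forall>M \<in> \<M>. submodule (\<alpha> M) R M) \<and>
     (\<forall>M \<in> \<M>. \<forall>N \<in> \<M>. \<forall>\<phi> \<in> mod_iso R M N. \<phi> ` \<alpha> M = \<alpha> N)"

definition interior_operation ::
    "('r, 's) ring_scheme \<Rightarrow> ('r, 'm) module set \<Rightarrow> (('r, 'm) module \<Rightarrow> 'm set) \<Rightarrow> bool" where
  "interior_operation R \<M> i \<longleftrightarrow> submodule_selector R \<M> i \<and>
     (\<forall>M \<in> \<M>. \<forall>L. submodule L R M \<and> sub_mod M L \<in> \<M> \<longrightarrow> i (sub_mod M L) \<subseteq> i M) \<and>
     (\<forall>M \<in> \<M>. sub_mod M (i M) \<in> \<M> \<longrightarrow> i (sub_mod M (i M)) = i M)"

text \<open>The value of a selector on a module \<open>X\<close>, possibly over another type, that is isomorphic to a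
  member of the class. Compatibility with isomorphisms makes it independent of the choices.\<close>

definition selector_upto_iso ::
    "('r, 's) ring_scheme \<Rightarrow> ('r, 'm) module set \<Rightarrow> (('r, 'm) module \<Rightarrow> 'm set)
       \<Rightarrow> ('r, 'x) module \<Rightarrow> 'x set" where
  "selector_upto_iso R \<M> \<alpha> X = {x \<in> carrier X. \<exists>M \<in> \<M>. \<exists>\<phi> \<in> mod_iso R X M. \<phi> x \<in> \<alpha> M}"

definition dual_class ::
    "('r, 's) ring_scheme \<Rightarrow> ('r, 'e) module \<Rightarrow> ('r, 'm) module set \<Rightarrow> ('r, 'n) module set" where
  "dual_class R E \<M> = {N. module R N \<and> (\<exists>M \<in> \<M>. mod_iso R N (dual_mod R E M) \<noteq> {})}"

text \<open>\<open>\<alpha>(N) = (N\<^sup>\<or>/i(N\<^sup>\<or>))\<^sup>\<or> \<subseteq> N\<^sup>\<or>\<^sup>\<or>\<close>, pulled back to \<open>N\<close> along the natural map. It is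
  meant for \<open>N\<close> in \<open>dual_class R E \<M>\<close>, where \<open>N\<^sup>\<or>\<close> is isomorphic to a member of \<open>\<M>\<close>.\<close>

definition dual_selector ::
    "('r, 's) ring_scheme \<Rightarrow> ('r, 'e) module \<Rightarrow> ('r, 'm) module set \<Rightarrow> (('r, 'm) module \<Rightarrow> 'm set)
       \<Rightarrow> ('r, 'n) module \<Rightarrow> 'n set" where
  "dual_selector R E \<M> i N =
     {x \<in> carrier N. dual_eval R E N x
        \<in> quot_dual R E (dual_mod R E N) (selector_upto_iso R \<M> i (dual_mod R E N))}"

definition residual_closure ::
    "(('r, 'n set) module \<Rightarrow> 'n set set) \<Rightarrow> ('r, 'n) module \<Rightarrow> 'n set \<Rightarrow> 'n set" where
  "residual_closure \<alpha> M L = {x \<in> carrier M. L +>\<^bsub>M\<^esub> x \<in> \<alpha> (quot_mod M L)}"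


section \<open>Expansions and reductions\<close>

definition expansions ::
    "('r, 's) ring_scheme \<Rightarrow> (('r, 'm) module \<Rightarrow> 'm set) \<Rightarrow> ('r, 'm) module \<Rightarrow> 'm set \<Rightarrow> 'm set set" where
  "expansions R i B A = {C. submodule C R B \<and> A \<subseteq> C \<and> i (sub_mod B A) = i (sub_mod B C)}"

text \<open>\<open>\<N>\<close> is the class on which the closure operation \<open>cl\<close> is defined.\<close>

definition reductions ::
    "('r, 's) ring_scheme \<Rightarrow> ('r, 'n) module set \<Rightarrow> (('r, 'n) module \<Rightarrow> 'n set \<Rightarrow> 'n set)
       \<Rightarrow> ('r, 'n) module \<Rightarrow> 'n set \<Rightarrow> 'n set set" where
  "reductions R \<N> cl M N =
     {L. submodule L R M \<and> submodule N R M \<and> L \<subseteq> N \<and>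
         M \<in> \<N> \<and> sub_mod M N \<in> \<N> \<and> sub_mod M L \<in> \<N> \<and> cl M L = cl M N}"

end

theory Submission
  imports Defs
begin

text \<open>
  By Baer's criterion, in a form that extends linear graphs by Zorn's lemma, and because \<open>E\<close> contains a
  nonzero element killed by the maximal ideal, maps to \<open>E\<close> separate every submodule from the points
  outside it. Applied to \<open>C \<subseteq> B\<close> this recovers \<open>C\<close> as the annihilator of \<open>(B/C)\<^sup>\<or>\<close>; applied to
  \<open>L \<subseteq> B\<^sup>\<or>\<close> it shows, since every map \<open>B\<^sup>\<or> \<rightarrow> E\<close> is evaluation at a point of \<open>B\<close>, that \<open>L = (B/C)\<^sup>\<or>\<close> for
  \<open>C\<close> the annihilator of \<open>L\<close>. Hence \<open>C \<mapsto> (B/C)\<^sup>\<or>\<close> is an anti-isomorphism between the lattices of all submodules.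
  For \<open>L = (B/C)\<^sup>\<or>\<close> evaluation also identifies \<open>(B\<^sup>\<or>/L)\<^sup>\<or>\<close> with \<open>C\<close>, so that the closure of \<open>(B/C)\<^sup>\<or>\<close> is
  \<open>(B/i(C))\<^sup>\<or>\<close>, and two submodules have the same interior iff their duals have the same closure.
\<close>

section \<open>Submodules, homomorphisms and quotients\<close>

lemma submoduleD:
  assumes "module R M" and "submodule H R M"
  shows "H \<subseteq> carrier M" and "\<zero>\<^bsub>M\<^esub> \<in> H"
    and "\<And>x y. x \<in> H \<Longrightarrow> y \<in> H \<Longrightarrow> x \<oplus>\<^bsub>M\<^esub> y \<in> H"
    and "\<And>x. x \<in> H \<Longrightarrow> \<ominus>\<^bsub>M\<^esub> x \<in> H"
    and "\<And>r x. r \<in> carrier R \<Longrightarrow> x \<in> H \<Longrightarrow> r \<odot>\<^bsub>M\<^esub> x \<in> H"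
    and "abelian_subgroup H M"
proof -
  interpret module R M by fact
  note sub = submoduleE[OF assms(2)]
  show "H \<subseteq> carrier M" "\<And>x y. x \<in> H \<Longrightarrow> y \<in> H \<Longrightarrow> x \<oplus>\<^bsub>M\<^esub> y \<in> H"
    "\<And>x. x \<in> H \<Longrightarrow> \<ominus>\<^bsub>M\<^esub> x \<in> H" "\<And>r x. r \<in> carrier R \<Longrightarrow> x \<in> H \<Longrightarrow> r \<odot>\<^bsub>M\<^esub> x \<in> H"
    using sub by auto
  have grp: "subgroup H (add_monoid M)"
    using assms(2) by (rule submodule.axioms)
  then show "\<zero>\<^bsub>M\<^esub> \<in> H"
    using subgroup.one_closed by fastforce
  show "abelian_subgroup H M"
    using grp abelian_group_axioms
    by (intro abelian_subgroupI3 additive_subgroup.intro)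
qed

lemma mod_homD:
  assumes "f \<in> mod_hom R M N"
  shows "\<And>x. x \<in> carrier M \<Longrightarrow> f x \<in> carrier N"
    and "\<And>x y. x \<in> carrier M \<Longrightarrow> y \<in> carrier M \<Longrightarrow> f (x \<oplus>\<^bsub>M\<^esub> y) = f x \<oplus>\<^bsub>N\<^esub> f y"
    and "\<And>r x. r \<in> carrier R \<Longrightarrow> x \<in> carrier M \<Longrightarrow> f (r \<odot>\<^bsub>M\<^esub> x) = r \<odot>\<^bsub>N\<^esub> f x"
  using assms unfolding mod_hom_def by auto

lemma mod_homI:
  assumes "\<And>x. x \<in> carrier M \<Longrightarrow> f x \<in> carrier N"
    and "\<And>x y. x \<in> carrier M \<Longrightarrow> y \<in> carrier M \<Longrightarrow> f (x \<oplus>\<^bsub>M\<^esub> y) = f x \<oplus>\<^bsub>N\<^esub> f y"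
    and "\<And>r x. r \<in> carrier R \<Longrightarrow> x \<in> carrier M \<Longrightarrow> f (r \<odot>\<^bsub>M\<^esub> x) = r \<odot>\<^bsub>N\<^esub> f x"
  shows "f \<in> mod_hom R M N"
  using assms unfolding mod_hom_def by auto

lemma mod_hom_zero:
  assumes "module R M" and "module R N" and "f \<in> mod_hom R M N"
  shows "f \<zero>\<^bsub>M\<^esub> = \<zero>\<^bsub>N\<^esub>"
proof -
  interpret M: module R M by fact
  interpret N: module R N by fact
  have "f (\<zero>\<^bsub>R\<^esub> \<odot>\<^bsub>M\<^esub> \<zero>\<^bsub>M\<^esub>) = \<zero>\<^bsub>R\<^esub> \<odot>\<^bsub>N\<^esub> f \<zero>\<^bsub>M\<^esub>"
    by (rule mod_homD(3)[OF assms(3)]) auto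
  then show ?thesis
    using mod_homD(1)[OF assms(3), of "\<zero>\<^bsub>M\<^esub>"] by simp
qed

lemma mod_iso_comp:
  assumes "f \<in> mod_iso R M N" and "g \<in> mod_iso R N P"
  shows "g \<circ> f \<in> mod_iso R M P"
proof -
  have f: "f \<in> mod_hom R M N" and g: "g \<in> mod_hom R N P"
    and bij: "bij_betw (g \<circ> f) (carrier M) (carrier P)"
    using assms bij_betw_trans unfolding mod_iso_def by auto
  have "g \<circ> f \<in> mod_hom R M P"
    by (rule mod_homI) (simp_all add: mod_homD[OF f] mod_homD[OF g])
  with bij show ?thesis unfolding mod_iso_def by simp
qed

lemma mod_iso_inv:
  assumes "module R M" and "f \<in> mod_iso R M N"
  shows "inv_into (carrier M) f \<in> mod_iso R N M"
proof -
  interpret module R M by fact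
  have hom: "f \<in> mod_hom R M N" and bij: "bij_betw f (carrier M) (carrier N)"
    using assms(2) unfolding mod_iso_def by auto
  let ?g = "inv_into (carrier M) f"
  have g: "?g y \<in> carrier M" "f (?g y) = y" if "y \<in> carrier N" for y
    using that bij by (auto simp: bij_betw_def inv_into_into f_inv_into_f)
  have gf: "?g (f x) = x" if "x \<in> carrier M" for x
    using that bij by (auto simp: bij_betw_def)
  have "?g \<in> mod_hom R N M"
  proof (rule mod_homI)
    fix x y assume "x \<in> carrier N" "y \<in> carrier N"
    then show "?g (x \<oplus>\<^bsub>N\<^esub> y) = ?g x \<oplus>\<^bsub>M\<^esub> ?g y"
      using gf[of "?g x \<oplus>\<^bsub>M\<^esub> ?g y"] g mod_homD(2)[OF hom, of "?g x" "?g y"] by simp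
  next
    fix r y assume "r \<in> carrier R" "y \<in> carrier N"
    then show "?g (r \<odot>\<^bsub>N\<^esub> y) = r \<odot>\<^bsub>M\<^esub> ?g y"
      using gf[of "r \<odot>\<^bsub>M\<^esub> ?g y"] g mod_homD(3)[OF hom, of r "?g y"] by simp
  qed (use g in auto)
  then show ?thesis
    using bij unfolding mod_iso_def by (auto intro: bij_betw_inv_into)
qed

section \<open>Quotient modules computed on coset representatives\<close>

lemma quot_mod_add:
  assumes "module R M" and "submodule L R M" and "x \<in> carrier M" and "y \<in> carrier M"
  shows "(L +>\<^bsub>M\<^esub> x) \<oplus>\<^bsub>quot_mod M L\<^esub> (L +>\<^bsub>M\<^esub> y) = L +>\<^bsub>M\<^esub> (x \<oplus>\<^bsub>M\<^esub> y)"
  using abelian_subgroup.a_rcos_sum[OF submoduleD(6)[OF assms(1,2)] assms(3,4)]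
  by (simp add: quot_mod_def)

lemma coset_eq_iff:
  assumes "module R M" and "submodule L R M" and "x \<in> carrier M" and "y \<in> carrier M"
  shows "L +>\<^bsub>M\<^esub> x = L +>\<^bsub>M\<^esub> y \<longleftrightarrow> (\<exists>l\<in>L. x = l \<oplus>\<^bsub>M\<^esub> y)"
proof
  assume "L +>\<^bsub>M\<^esub> x = L +>\<^bsub>M\<^esub> y"
  then have "x \<in> L +>\<^bsub>M\<^esub> y"
    using abelian_subgroup.a_rcos_self[OF submoduleD(6)[OF assms(1,2)] assms(3)] by simp
  then show "\<exists>l\<in>L. x = l \<oplus>\<^bsub>M\<^esub> y"
    by (auto simp: a_r_coset_def')
next
  interpret module R M by fact
  assume "\<exists>l\<in>L. x = l \<oplus>\<^bsub>M\<^esub> y"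
  then obtain l where l: "l \<in> L" "x = l \<oplus>\<^bsub>M\<^esub> y" by blast
  have L: "L \<subseteq> carrier M" using submoduleD(1)[OF assms(1,2)] .
  have "L +>\<^bsub>M\<^esub> l = L"
    using a_coset_join2 l L submodule.axioms(1)[OF assms(2)] by blast
  then show "L +>\<^bsub>M\<^esub> x = L +>\<^bsub>M\<^esub> y"
    using l L assms(4) a_coset_add_assoc[OF L, of l y] by auto
qed

text \<open>The scalar action of \<open>quot_mod\<close> is a union over all representatives of a
  coset. Since \<open>L\<close> absorbs scalars, every representative contributes the same coset,
  and the union is over a nonempty set, so it equals that coset.\<close>

lemma quot_mod_smult:
  assumes "module R M" and "submodule L R M" and "r \<in> carrier R" and "x \<in> carrier M"
  shows "r \<odot>\<^bsub>quot_mod M L\<^esub> (L +>\<^bsub>M\<^esub> x) = L +>\<^bsub>M\<^esub> (r \<odot>\<^bsub>M\<^esub> x)"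
proof -
  interpret module R M by fact
  note sub = submoduleD[OF assms(1,2)]
  have "L +>\<^bsub>M\<^esub> (r \<odot>\<^bsub>M\<^esub> y) = L +>\<^bsub>M\<^esub> (r \<odot>\<^bsub>M\<^esub> x)" if y: "y \<in> L +>\<^bsub>M\<^esub> x" for y
  proof -
    obtain l where l: "l \<in> L" "y = l \<oplus>\<^bsub>M\<^esub> x"
      using y by (auto simp: a_r_coset_def')
    have "l \<in> carrier M" using l sub(1) by auto
    then have "r \<odot>\<^bsub>M\<^esub> y = r \<odot>\<^bsub>M\<^esub> l \<oplus>\<^bsub>M\<^esub> r \<odot>\<^bsub>M\<^esub> x" "y \<in> carrier M"
      using l assms by (auto simp: smult_r_distr)
    moreover have "r \<odot>\<^bsub>M\<^esub> l \<in> L" "r \<odot>\<^bsub>M\<^esub> l \<in> carrier M"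
      using sub(1,5) l assms by blast+
    ultimately show ?thesis
      using assms(3,4) by (subst coset_eq_iff[OF assms(1,2)]) auto
  qed
  then have "(\<Union>y\<in>L +>\<^bsub>M\<^esub> x. L +>\<^bsub>M\<^esub> (r \<odot>\<^bsub>M\<^esub> y)) = (\<Union>y\<in>L +>\<^bsub>M\<^esub> x. L +>\<^bsub>M\<^esub> (r \<odot>\<^bsub>M\<^esub> x))"
    by (intro SUP_cong refl)
  moreover have "L +>\<^bsub>M\<^esub> x \<noteq> {}"
    using abelian_subgroup.a_rcos_self[OF sub(6) assms(4)] by blast
  ultimately show ?thesis
    by (simp add: quot_mod_def)
qed

lemma quot_mod_carrier: "carrier (quot_mod M L) = (\<lambda>x. L +>\<^bsub>M\<^esub> x) ` carrier M"
  by (auto simp: quot_mod_def A_RCOSETS_def')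

lemma quot_mod_zero:
  assumes "module R M" and "submodule L R M"
  shows "\<zero>\<^bsub>quot_mod M L\<^esub> = L +>\<^bsub>M\<^esub> \<zero>\<^bsub>M\<^esub>"
proof -
  interpret module R M by fact
  show ?thesis
    using a_coset_add_zero[OF submoduleD(1)[OF assms]] by (simp add: quot_mod_def)
qed

lemma quot_mod_module:
  assumes "module R M" and "submodule L R M"
  shows "module R (quot_mod M L)"
proof -
  interpret module R M by fact
  note q = quot_mod_add[OF assms] quot_mod_smult[OF assms] quot_mod_zero[OF assms]
  show ?thesis
  proof (rule moduleI)
    show "abelian_group (quot_mod M L)"
    proof (rule abelian_groupI)
      fix U assume "U \<in> carrier (quot_mod M L)"
      then obtain x where x: "x \<in> carrier M" "U = L +>\<^bsub>M\<^esub> x"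
        by (auto simp: quot_mod_carrier)
      then show "\<exists>V\<in>carrier (quot_mod M L). V \<oplus>\<^bsub>quot_mod M L\<^esub> U = \<zero>\<^bsub>quot_mod M L\<^esub>"
        using q(1)[of "\<ominus>\<^bsub>M\<^esub> x" x]
        by (intro bexI[of _ "L +>\<^bsub>M\<^esub> (\<ominus>\<^bsub>M\<^esub> x)"])
          (auto simp: quot_mod_carrier q M.l_neg)
    qed (auto simp: quot_mod_carrier q M.a_ac)
  qed (auto simp: quot_mod_carrier q smult_l_distr smult_r_distr smult_assoc1 R.is_cring)
qed

section \<open>The ring as a module over itself\<close>

lemma self_mod_module:
  assumes "cring R"
  shows "module R (self_mod R)"
proof -
  interpret cring R by fact
  show ?thesis
  proof (rule moduleI)
    show "abelian_group (self_mod R)"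
    proof (rule abelian_groupI)
      fix x assume "x \<in> carrier (self_mod R)"
      then show "\<exists>y\<in>carrier (self_mod R). y \<oplus>\<^bsub>self_mod R\<^esub> x = \<zero>\<^bsub>self_mod R\<^esub>"
        by (auto simp: self_mod_def intro!: bexI[of _ "\<ominus>\<^bsub>R\<^esub> x"] l_neg)
    qed (auto simp: self_mod_def a_ac)
  qed (auto simp: self_mod_def l_distr r_distr m_assoc is_cring)
qed

lemma self_mod_submoduleI:
  assumes "cring R" and "J \<subseteq> carrier R" and "\<zero>\<^bsub>R\<^esub> \<in> J"
    and "\<And>x y. x \<in> J \<Longrightarrow> y \<in> J \<Longrightarrow> x \<oplus>\<^bsub>R\<^esub> y \<in> J"
    and "\<And>r x. r \<in> carrier R \<Longrightarrow> x \<in> J \<Longrightarrow> r \<otimes>\<^bsub>R\<^esub> x \<in> J"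
  shows "submodule J R (self_mod R)"
proof -
  interpret cring R by fact
  interpret S: module R "self_mod R" by (rule self_mod_module) fact
  \<comment> \<open>Negation is rewritten as multiplication by -1, so that closure under negatives
    follows from absorption of scalars.\<close>
  have eq: "\<ominus>\<^bsub>self_mod R\<^esub> x = (\<ominus>\<^bsub>R\<^esub> \<one>\<^bsub>R\<^esub>) \<otimes>\<^bsub>R\<^esub> x" if "x \<in> carrier R" for x
    using that S.smult_l_minus[of "\<one>\<^bsub>R\<^esub>" x] by (simp add: self_mod_def)
  have "\<ominus>\<^bsub>self_mod R\<^esub> x \<in> J" if "x \<in> J" for x
  proof -
    have "x \<in> carrier R" using that assms(2) by auto
    then show ?thesis using that assms(5)[of "\<ominus>\<^bsub>R\<^esub> \<one>\<^bsub>R\<^esub>" x] eq[of x] by simp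
  qed
  then show ?thesis
    by (intro S.submoduleI) (use assms in \<open>auto simp: self_mod_def\<close>)
qed

section \<open>Local rings and the residue field\<close>

lemma (in noetherian_ring) proper_ideal_in_maximal:
  assumes "ideal J R" and "J \<noteq> carrier R"
  shows "\<exists>I. maximalideal I R \<and> J \<subseteq> I"
proof -
  let ?S = "{I. ideal I R \<and> J \<subseteq> I \<and> I \<noteq> carrier R}"
  have "\<exists>I\<in>?S. \<forall>X\<in>?S. I \<subseteq> X \<longrightarrow> X = I"
  proof (rule subset_Zorn_nonempty)
    show "?S \<noteq> {}" using assms by auto
    \<comment> \<open>Properness of the union is immediate here: in a Noetherian ring a nonempty
      chain of ideals contains its own union.\<close>
    fix C assume C: "C \<noteq> {}" "subset.chain ?S C"
    then have "subset.chain {I. ideal I R} C"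
      unfolding subset_chain_def by auto
    then have "\<Union>C \<in> C" by (rule ideal_chain_is_trivial[OF C(1)])
    then show "\<Union>C \<in> ?S" using C(2) unfolding subset_chain_def by auto
  qed
  then obtain I where I: "I \<in> ?S" "\<forall>X\<in>?S. I \<subseteq> X \<longrightarrow> X = I"
    by (elim bexE)
  have "maximalideal I R"
  proof (rule maximalidealI)
    show "ideal I R" "carrier R \<noteq> I" using I(1) by auto
    fix X assume X: "ideal X R" "I \<subseteq> X"
    then have "X \<in> ?S" if "X \<noteq> carrier R"
      using that I(1) by auto
    then show "X = I \<or> X = carrier R"
      using I(2) X(2) by metis
  qed
  moreover have "J \<subseteq> I" using I(1) by simp
  ultimately show ?thesis by blast
qed

lemma max_ideal_maximalideal:
  assumes "local_ring R"
  shows "maximalideal (max_ideal R) R"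
  using assms theI'[of "\<lambda>m. maximalideal m R"]
  unfolding local_ring_def max_ideal_def by blast

text \<open>Some maximal ideal contains \<open>J\<close>, and locality leaves only one candidate.
  The lemma is later applied to the ideal of scalars that carry a given point into a
  submodule.\<close>

lemma proper_ideal_subset_max_ideal:
  assumes "local_ring R" and "noetherian_ring R" and "ideal J R" and "\<one>\<^bsub>R\<^esub> \<notin> J"
  shows "J \<subseteq> max_ideal R"
proof -
  interpret noetherian_ring R by fact
  have "J \<noteq> carrier R" using assms(4) by auto
  then obtain I where "maximalideal I R" "J \<subseteq> I"
    using proper_ideal_in_maximal[OF assms(3)] by blast
  moreover have "I = max_ideal R" if "maximalideal I R"
    using that max_ideal_maximalideal[OF assms(1)] assms(1)
    unfolding local_ring_def by blast
  ultimately show ?thesis by blast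
qed

text \<open>The element is the image of the class of 1 under the embedding of the residue field into
  \<open>E\<close>. It is nonzero because 1 lies outside the maximal ideal and the embedding is
  injective, and it is killed by the maximal ideal because the residue field is.\<close>

lemma injective_hull_socle_element:
  assumes "local_ring R" and "injective_hull R (residue_field_mod R) E"
  obtains u where "u \<in> carrier E" and "u \<noteq> \<zero>\<^bsub>E\<^esub>"
    and "\<And>r. r \<in> max_ideal R \<Longrightarrow> r \<odot>\<^bsub>E\<^esub> u = \<zero>\<^bsub>E\<^esub>"
proof -
  let ?m = "max_ideal R" and ?S = "self_mod R"
  have cring: "cring R" using assms(1) unfolding local_ring_def by blast
  interpret R: cring R by fact
  interpret m: maximalideal ?m R by (rule max_ideal_maximalideal) fact
  have S: "module R ?S" using self_mod_module[OF cring] .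
  have sub: "submodule ?m R ?S"
    by (rule self_mod_submoduleI[OF cring])
      (auto simp: m.I_l_closed m.a_closed)
  have E: "module R E" using assms(2) unfolding injective_hull_def injective_mod_def by blast
  obtain \<iota> where \<iota>: "\<iota> \<in> mod_hom R (quot_mod ?S ?m) E" "inj_on \<iota> (carrier (quot_mod ?S ?m))"
    using assms(2) unfolding injective_hull_def residue_field_mod_def by blast
  have one: "\<one>\<^bsub>R\<^esub> \<in> carrier ?S" by (simp add: self_mod_def)
  have zero: "\<zero>\<^bsub>?S\<^esub> = \<zero>\<^bsub>R\<^esub>" "\<zero>\<^bsub>?S\<^esub> \<in> carrier ?S" by (auto simp: self_mod_def)
  have coset: "?m +>\<^bsub>?S\<^esub> x = ?m +>\<^bsub>?S\<^esub> \<zero>\<^bsub>?S\<^esub> \<longleftrightarrow> x \<in> ?m" if "x \<in> carrier R" for x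
    using that coset_eq_iff[OF S sub, of x "\<zero>\<^bsub>?S\<^esub>"] m.a_subset by (auto simp: self_mod_def)
  have \<iota>0: "\<iota> (?m +>\<^bsub>?S\<^esub> \<zero>\<^bsub>?S\<^esub>) = \<zero>\<^bsub>E\<^esub>"
    using mod_hom_zero[OF quot_mod_module[OF S sub] E \<iota>(1)] quot_mod_zero[OF S sub] by simp
  let ?u = "\<iota> (?m +>\<^bsub>?S\<^esub> \<one>\<^bsub>R\<^esub>)"
  show ?thesis
  proof (rule that)
    show "?u \<in> carrier E"
      using one by (intro mod_homD(1)[OF \<iota>(1)]) (auto simp: quot_mod_carrier)
    have "\<one>\<^bsub>R\<^esub> \<notin> ?m" using m.I_notcarr m.one_imp_carrier by blast
    then have "?m +>\<^bsub>?S\<^esub> \<one>\<^bsub>R\<^esub> \<noteq> ?m +>\<^bsub>?S\<^esub> \<zero>\<^bsub>?S\<^esub>"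
      using coset by simp
    then show "?u \<noteq> \<zero>\<^bsub>E\<^esub>"
      using \<iota>0 inj_onD[OF \<iota>(2), of "?m +>\<^bsub>?S\<^esub> \<one>\<^bsub>R\<^esub>" "?m +>\<^bsub>?S\<^esub> \<zero>\<^bsub>?S\<^esub>"] one zero
      by (auto simp: quot_mod_carrier)
    fix r assume r: "r \<in> ?m"
    then have rR: "r \<in> carrier R" using m.a_subset by auto
    have "r \<odot>\<^bsub>E\<^esub> ?u = \<iota> (r \<odot>\<^bsub>quot_mod ?S ?m\<^esub> (?m +>\<^bsub>?S\<^esub> \<one>\<^bsub>R\<^esub>))"
      using mod_homD(3)[OF \<iota>(1) rR] one by (auto simp: quot_mod_carrier)
    also have "\<dots> = \<iota> (?m +>\<^bsub>?S\<^esub> r)"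
      using quot_mod_smult[OF S sub rR one] rR by (simp add: self_mod_def)
    also have "\<dots> = \<zero>\<^bsub>E\<^esub>"
      using coset[OF rR] r \<iota>0 by simp
    finally show "r \<odot>\<^bsub>E\<^esub> ?u = \<zero>\<^bsub>E\<^esub>" .
  qed
qed

section \<open>Extension of maps into an injective module\<close>

text \<open>Homomorphisms from submodules of \<open>X\<close> to \<open>E\<close>, encoded by their graphs; single-valuedness need
  only be required at \<open>0\<close>.\<close>

definition linear_graph ::
    "('r, 's) ring_scheme \<Rightarrow> ('r, 'm) module \<Rightarrow> ('r, 'e) module \<Rightarrow> ('m \<times> 'e) set \<Rightarrow> bool" where
  "linear_graph R X E G \<longleftrightarrow> G \<subseteq> carrier X \<times> carrier E \<and> (\<zero>\<^bsub>X\<^esub>, \<zero>\<^bsub>E\<^esub>) \<in> G \<and>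
     (\<forall>x e y d. (x, e) \<in> G \<and> (y, d) \<in> G \<longrightarrow> (x \<oplus>\<^bsub>X\<^esub> y, e \<oplus>\<^bsub>E\<^esub> d) \<in> G) \<and>
     (\<forall>r \<in> carrier R. \<forall>x e. (x, e) \<in> G \<longrightarrow> (r \<odot>\<^bsub>X\<^esub> x, r \<odot>\<^bsub>E\<^esub> e) \<in> G) \<and>
     (\<forall>e. (\<zero>\<^bsub>X\<^esub>, e) \<in> G \<longrightarrow> e = \<zero>\<^bsub>E\<^esub>)"

lemma linear_graphD:
  assumes "linear_graph R X E G"
  shows "\<And>x e. (x, e) \<in> G \<Longrightarrow> x \<in> carrier X" and "\<And>x e. (x, e) \<in> G \<Longrightarrow> e \<in> carrier E"
    and "(\<zero>\<^bsub>X\<^esub>, \<zero>\<^bsub>E\<^esub>) \<in> G"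
    and "\<And>x e y d. (x, e) \<in> G \<Longrightarrow> (y, d) \<in> G \<Longrightarrow> (x \<oplus>\<^bsub>X\<^esub> y, e \<oplus>\<^bsub>E\<^esub> d) \<in> G"
    and "\<And>r x e. r \<in> carrier R \<Longrightarrow> (x, e) \<in> G \<Longrightarrow> (r \<odot>\<^bsub>X\<^esub> x, r \<odot>\<^bsub>E\<^esub> e) \<in> G"
    and "\<And>e. (\<zero>\<^bsub>X\<^esub>, e) \<in> G \<Longrightarrow> e = \<zero>\<^bsub>E\<^esub>"
  using assms unfolding linear_graph_def by blast+

lemma linear_graph_minus:
  assumes "module R X" and "module R E" and "linear_graph R X E G" and "(x, e) \<in> G"
  shows "(\<ominus>\<^bsub>X\<^esub> x, \<ominus>\<^bsub>E\<^esub> e) \<in> G"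
proof -
  interpret X: module R X by fact
  interpret E: module R E by fact
  note G = linear_graphD[OF assms(3)]
  have "x \<in> carrier X" "e \<in> carrier E" using G(1,2) assms(4) by auto
  then show ?thesis
    using G(5)[of "\<ominus>\<^bsub>R\<^esub> \<one>\<^bsub>R\<^esub>", OF _ assms(4)] by (simp add: X.smult_l_minus E.smult_l_minus)
qed

text \<open>The difference of the two pairs is a pair over 0, where single-valuedness is built into
  \<open>linear_graph\<close>.\<close>

lemma linear_graph_unique:
  assumes "module R X" and "module R E" and "linear_graph R X E G" and "(x, e) \<in> G" and "(x, d) \<in> G"
  shows "e = d"
proof -
  interpret X: module R X by fact
  interpret E: module R E by fact
  note G = linear_graphD[OF assms(3)]
  have car: "x \<in> carrier X" "e \<in> carrier E" "d \<in> carrier E" using G(1,2) assms(4,5) by auto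
  have "(x \<oplus>\<^bsub>X\<^esub> (\<ominus>\<^bsub>X\<^esub> x), e \<oplus>\<^bsub>E\<^esub> (\<ominus>\<^bsub>E\<^esub> d)) \<in> G"
    by (rule G(4)[OF assms(4) linear_graph_minus[OF assms(1,2,3,5)]])
  then have "e \<oplus>\<^bsub>E\<^esub> (\<ominus>\<^bsub>E\<^esub> d) = \<zero>\<^bsub>E\<^esub>"
    using G(6) car by (simp add: X.r_neg)
  then show ?thesis
    using car E.minus_unique E.minus_minus E.add.inv_closed
    by (metis E.add.inv_equality E.add.m_comm)
qed

text \<open>This is the one-step extension in Baer's criterion. The scalars carrying
  \<open>y\<close> into the domain form an ideal, on which \<open>G\<close> induces a map to
  \<open>E\<close>; injectivity extends that map to all of \<open>R\<close>, and its value at 1 is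
  an admissible value at \<open>y\<close>.\<close>

lemma linear_graph_extend:
  fixes R :: "('r, 's) ring_scheme"
  assumes inj: "injective_mod R E" and X: "module R X" and G: "linear_graph R X E G"
    and y: "y \<in> carrier X"
  shows "\<exists>G'. linear_graph R X E G' \<and> G \<subseteq> G' \<and> y \<in> Domain G'"
proof -
  have E: "module R E" using inj unfolding injective_mod_def by blast
  interpret X: module R X by fact
  interpret E: module R E by fact
  note g = linear_graphD[OF G]
  \<comment> \<open>\<open>J\<close> is the ideal of scalars that carry \<open>y\<close> into the
    domain of \<open>G\<close>, and \<open>f\<close> sends such a scalar \<open>r\<close> to the
    value of \<open>G\<close> at \<open>r\<close> times \<open>y\<close>.\<close>
  define J where "J = {r \<in> carrier R. r \<odot>\<^bsub>X\<^esub> y \<in> Domain G}"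
  define f where "f r = (THE e. (r \<odot>\<^bsub>X\<^esub> y, e) \<in> G)" for r
  have f_eq: "f r = e" if "(r \<odot>\<^bsub>X\<^esub> y, e) \<in> G" for r e
    unfolding f_def using linear_graph_unique[OF X E G] that by (intro the_equality)
  have fJ: "(r \<odot>\<^bsub>X\<^esub> y, f r) \<in> G" "r \<in> carrier R" if "r \<in> J" for r
    using that f_eq unfolding J_def by auto
  have JI: "r \<in> J" if "r \<in> carrier R" "(r \<odot>\<^bsub>X\<^esub> y, e) \<in> G" for r e
    using that unfolding J_def by auto
  have f_add: "((r \<oplus>\<^bsub>R\<^esub> s) \<odot>\<^bsub>X\<^esub> y, f r \<oplus>\<^bsub>E\<^esub> f s) \<in> G" if "r \<in> J" "s \<in> J" for r s
    using g(4)[OF fJ(1)[OF that(1)] fJ(1)[OF that(2)]] fJ(2) that y by (simp add: X.smult_l_distr)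
  have f_smult: "((r \<otimes>\<^bsub>R\<^esub> s) \<odot>\<^bsub>X\<^esub> y, r \<odot>\<^bsub>E\<^esub> f s) \<in> G" if "r \<in> carrier R" "s \<in> J" for r s
    using g(5)[OF that(1) fJ(1)[OF that(2)]] fJ(2) that y by (simp add: X.smult_assoc1)
  have sub: "submodule J R (self_mod R)"
  proof (rule self_mod_submoduleI[OF X.R.is_cring])
    show "J \<subseteq> carrier R" unfolding J_def by blast
    show "\<zero>\<^bsub>R\<^esub> \<in> J" using JI[of "\<zero>\<^bsub>R\<^esub>"] g(3) y by simp
    show "r \<oplus>\<^bsub>R\<^esub> s \<in> J" if "r \<in> J" "s \<in> J" for r s
      using JI[OF _ f_add[OF that]] fJ(2) that by simp
    show "r \<otimes>\<^bsub>R\<^esub> s \<in> J" if "r \<in> carrier R" "s \<in> J" for r s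
      using JI[OF _ f_smult[OF that]] fJ(2) that by simp
  qed
  have f_hom: "f \<in> mod_hom R (sub_mod (self_mod R) J) E"
  proof (rule mod_homI)
    show "f r \<in> carrier E" if "r \<in> carrier (sub_mod (self_mod R) J)" for r
      using that fJ(1) g(2) by auto
    show "f (r \<oplus>\<^bsub>sub_mod (self_mod R) J\<^esub> s) = f r \<oplus>\<^bsub>E\<^esub> f s"
      if "r \<in> carrier (sub_mod (self_mod R) J)" "s \<in> carrier (sub_mod (self_mod R) J)" for r s
      using that f_eq[OF f_add, of r s] by (simp add: self_mod_def)
    show "f (r \<odot>\<^bsub>sub_mod (self_mod R) J\<^esub> s) = r \<odot>\<^bsub>E\<^esub> f s"
      if "r \<in> carrier R" "s \<in> carrier (sub_mod (self_mod R) J)" for r s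
      using that f_eq[OF f_smult, of r s] by (simp add: self_mod_def)
  qed
  obtain h where h: "h \<in> mod_hom R (self_mod R) E" "\<forall>z\<in>J. h z = f z"
    using inj self_mod_module[OF X.R.is_cring] sub f_hom unfolding injective_mod_def by blast
  \<comment> \<open>The extension \<open>h\<close> of \<open>f\<close> is determined by its value at
    1, so \<open>h r\<close> is \<open>r\<close> times \<open>u\<close>; in particular
    \<open>u\<close> agrees with \<open>G\<close> on every multiple of \<open>y\<close> that lies in
    the domain.\<close>
  define u where "u = h \<one>\<^bsub>R\<^esub>"
  have u: "u \<in> carrier E"
    unfolding u_def by (rule mod_homD(1)[OF h(1)]) (simp add: self_mod_def)
  have hu: "h r = r \<odot>\<^bsub>E\<^esub> u" if "r \<in> carrier R" for r
    using mod_homD(3)[OF h(1) that, of "\<one>\<^bsub>R\<^esub>"] that unfolding u_def by (simp add: self_mod_def)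
  \<comment> \<open>The graph of the map that extends \<open>G\<close> to the sum of its domain and
    the submodule generated by \<open>y\<close>, with \<open>y\<close> sent to
    \<open>u\<close>.\<close>
  define G' where
    "G' = {(a \<oplus>\<^bsub>X\<^esub> r \<odot>\<^bsub>X\<^esub> y, b \<oplus>\<^bsub>E\<^esub> r \<odot>\<^bsub>E\<^esub> u) | a b r. (a, b) \<in> G \<and> r \<in> carrier R}"
  have G'I: "(x, e) \<in> G'"
    if "(a, b) \<in> G" "r \<in> carrier R" "x = a \<oplus>\<^bsub>X\<^esub> r \<odot>\<^bsub>X\<^esub> y" "e = b \<oplus>\<^bsub>E\<^esub> r \<odot>\<^bsub>E\<^esub> u" for x e a b r
    using that unfolding G'_def by blast
  have G'E: "\<exists>a b r. (a, b) \<in> G \<and> a \<in> carrier X \<and> b \<in> carrier E \<and> r \<in> carrier R \<and>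
      x = a \<oplus>\<^bsub>X\<^esub> r \<odot>\<^bsub>X\<^esub> y \<and> e = b \<oplus>\<^bsub>E\<^esub> r \<odot>\<^bsub>E\<^esub> u"
    if "(x, e) \<in> G'" for x e
    using that g(1,2) unfolding G'_def by blast
  have "linear_graph R X E G'"
    unfolding linear_graph_def
  proof (intro conjI allI ballI impI)
    show "G' \<subseteq> carrier X \<times> carrier E"
    proof (rule subrelI)
      fix x e assume "(x, e) \<in> G'"
      from G'E[OF this] show "(x, e) \<in> carrier X \<times> carrier E" using y u by auto
    qed
    show "(\<zero>\<^bsub>X\<^esub>, \<zero>\<^bsub>E\<^esub>) \<in> G'"
      by (rule G'I[OF g(3), of "\<zero>\<^bsub>R\<^esub>"]) (use y u in auto)
  next
    fix x e x' e' assume "(x, e) \<in> G' \<and> (x', e') \<in> G'"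
    then obtain a b r a' b' r' where
      *: "(a, b) \<in> G" "a \<in> carrier X" "b \<in> carrier E" "r \<in> carrier R"
        "(a', b') \<in> G" "a' \<in> carrier X" "b' \<in> carrier E" "r' \<in> carrier R"
      and **: "x = a \<oplus>\<^bsub>X\<^esub> r \<odot>\<^bsub>X\<^esub> y" "e = b \<oplus>\<^bsub>E\<^esub> r \<odot>\<^bsub>E\<^esub> u"
        "x' = a' \<oplus>\<^bsub>X\<^esub> r' \<odot>\<^bsub>X\<^esub> y" "e' = b' \<oplus>\<^bsub>E\<^esub> r' \<odot>\<^bsub>E\<^esub> u"
      using G'E by metis
    show "(x \<oplus>\<^bsub>X\<^esub> x', e \<oplus>\<^bsub>E\<^esub> e') \<in> G'"
      by (rule G'I[OF g(4)[OF *(1,5)], of "r \<oplus>\<^bsub>R\<^esub> r'"])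
        (use * u y in \<open>simp_all add: ** X.smult_l_distr E.smult_l_distr X.M.a_ac E.M.a_ac\<close>)
  next
    fix s x e assume s: "s \<in> carrier R" and "(x, e) \<in> G'"
    then obtain a b r where
      *: "(a, b) \<in> G" "a \<in> carrier X" "b \<in> carrier E" "r \<in> carrier R"
      and **: "x = a \<oplus>\<^bsub>X\<^esub> r \<odot>\<^bsub>X\<^esub> y" "e = b \<oplus>\<^bsub>E\<^esub> r \<odot>\<^bsub>E\<^esub> u"
      using G'E by metis
    show "(s \<odot>\<^bsub>X\<^esub> x, s \<odot>\<^bsub>E\<^esub> e) \<in> G'"
      by (rule G'I[OF g(5)[OF s *(1)], of "s \<otimes>\<^bsub>R\<^esub> r"])
        (use * s u y in \<open>simp_all add: ** X.smult_r_distr E.smult_r_distr X.smult_assoc1 E.smult_assoc1\<close>)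
  next
    \<comment> \<open>Single-valuedness at 0 is where the choice of \<open>u\<close> matters. If
      \<open>a\<close> plus \<open>r\<close> times \<open>y\<close> is 0, then \<open>r\<close>
      times \<open>y\<close> is the negative of \<open>a\<close> and lies in the domain, so
      \<open>r\<close> is in \<open>J\<close>; hence \<open>r\<close> times \<open>u\<close> equals
      \<open>f r\<close>, which is the negative of \<open>b\<close>.\<close>
    fix e assume "(\<zero>\<^bsub>X\<^esub>, e) \<in> G'"
    then obtain a b r where
      *: "(a, b) \<in> G" "a \<in> carrier X" "b \<in> carrier E" "r \<in> carrier R"
      and **: "\<zero>\<^bsub>X\<^esub> = a \<oplus>\<^bsub>X\<^esub> r \<odot>\<^bsub>X\<^esub> y" "e = b \<oplus>\<^bsub>E\<^esub> r \<odot>\<^bsub>E\<^esub> u"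
      using G'E by metis
    have "\<ominus>\<^bsub>X\<^esub> a = r \<odot>\<^bsub>X\<^esub> y"
      using **(1) * y X.M.minus_equality[of "r \<odot>\<^bsub>X\<^esub> y" a] by (simp add: X.M.a_comm)
    then have ry: "(r \<odot>\<^bsub>X\<^esub> y, \<ominus>\<^bsub>E\<^esub> b) \<in> G"
      using linear_graph_minus[OF X E G *(1)] by simp
    then have "r \<odot>\<^bsub>E\<^esub> u = \<ominus>\<^bsub>E\<^esub> b"
      using h(2) hu[OF *(4)] JI[OF *(4) ry] f_eq[OF ry] by simp
    then show "e = \<zero>\<^bsub>E\<^esub>"
      using ** * by (simp add: E.M.r_neg)
  qed
  moreover have "G \<subseteq> G'"
  proof (rule subrelI)
    fix a b assume ab: "(a, b) \<in> G"
    show "(a, b) \<in> G'"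
      by (rule G'I[OF ab, of "\<zero>\<^bsub>R\<^esub>"]) (use g(1,2)[OF ab] y u in auto)
  qed
  moreover have "(y, u) \<in> G'"
    by (rule G'I[OF g(3), of "\<one>\<^bsub>R\<^esub>"]) (use y u in auto)
  ultimately show ?thesis by blast
qed

text \<open>Members of a chain are comparable, so any two pairs of the union already lie in a common
  member, where the closure conditions hold.\<close>

lemma linear_graph_Union_chain:
  assumes "C \<noteq> {}" and "subset.chain {G. linear_graph R X E G} C"
  shows "linear_graph R X E (\<Union>C)"
proof -
  have lin: "\<And>G. G \<in> C \<Longrightarrow> linear_graph R X E G"
    using assms(2) unfolding subset_chain_def by blast
  have dir: "\<And>G H. G \<in> C \<Longrightarrow> H \<in> C \<Longrightarrow> G \<subseteq> H \<or> H \<subseteq> G"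
    using assms(2) unfolding subset_chain_def by blast
  show ?thesis
    unfolding linear_graph_def
  proof (intro conjI allI ballI impI)
    show "\<Union>C \<subseteq> carrier X \<times> carrier E"
      using lin unfolding linear_graph_def by blast
    show "(\<zero>\<^bsub>X\<^esub>, \<zero>\<^bsub>E\<^esub>) \<in> \<Union>C"
      using assms(1) linear_graphD(3)[OF lin] by blast
    fix x e y d assume "(x, e) \<in> \<Union>C \<and> (y, d) \<in> \<Union>C"
    then obtain G H where "G \<in> C" "(x, e) \<in> G" "H \<in> C" "(y, d) \<in> H"
      by blast
    then obtain G where "G \<in> C" "(x, e) \<in> G" "(y, d) \<in> G"
      using dir[of G H] by blast
    then show "(x \<oplus>\<^bsub>X\<^esub> y, e \<oplus>\<^bsub>E\<^esub> d) \<in> \<Union>C"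
      using linear_graphD(4)[OF lin] by blast
  next
    fix r x e assume "r \<in> carrier R" "(x, e) \<in> \<Union>C"
    then show "(r \<odot>\<^bsub>X\<^esub> x, r \<odot>\<^bsub>E\<^esub> e) \<in> \<Union>C"
      using linear_graphD(5)[OF lin] by blast
  next
    fix e assume "(\<zero>\<^bsub>X\<^esub>, e) \<in> \<Union>C"
    then show "e = \<zero>\<^bsub>E\<^esub>" using linear_graphD(6)[OF lin] by blast
  qed
qed

text \<open>A graph that is maximal by Zorn's lemma has full domain, since otherwise the one-step
  extension would enlarge it. The elements of \<open>X\<close> may have any type, although
  \<open>injective_mod\<close> only tests modules on the type of the elements of
  \<open>R\<close>.\<close>

lemma injective_mod_graph_extension:
  assumes inj: "injective_mod R E" and X: "module R X" and G: "linear_graph R X E G"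
  obtains f where "f \<in> mod_hom R X E" and "\<And>x e. (x, e) \<in> G \<Longrightarrow> f x = e"
proof -
  have E: "module R E" using inj unfolding injective_mod_def by blast
  let ?S = "{H. linear_graph R X E H \<and> G \<subseteq> H}"
  have "\<exists>H\<in>?S. \<forall>K\<in>?S. H \<subseteq> K \<longrightarrow> K = H"
  proof (rule subset_Zorn_nonempty)
    show "?S \<noteq> {}" using G by blast
    fix C assume C: "C \<noteq> {}" "subset.chain ?S C"
    then have "subset.chain {H. linear_graph R X E H} C"
      unfolding subset_chain_def by blast
    then have "linear_graph R X E (\<Union>C)"
      by (rule linear_graph_Union_chain[OF C(1)])
    moreover have "G \<subseteq> \<Union>C"
      using C unfolding subset_chain_def by blast
    ultimately show "\<Union>C \<in> ?S" by blast
  qed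
  then obtain H where H: "H \<in> ?S" "\<forall>K\<in>?S. H \<subseteq> K \<longrightarrow> K = H"
    by (elim bexE)
  have lin: "linear_graph R X E H" and GH: "G \<subseteq> H" using H(1) by auto
  note h = linear_graphD[OF lin]
  \<comment> \<open>Maximality turns the one-step extension at \<open>x\<close> into equality, so
    \<open>x\<close> was in the domain already.\<close>
  have dom: "\<exists>e. (x, e) \<in> H" if x: "x \<in> carrier X" for x
  proof -
    obtain K where K: "linear_graph R X E K" "H \<subseteq> K" "x \<in> Domain K"
      using linear_graph_extend[OF inj X lin x] by blast
    have "K \<in> ?S" using K(1,2) GH by auto
    then have "K = H" using H(2) K(2) by metis
    then show ?thesis using K(3) by blast
  qed
  define f where "f x = (THE e. (x, e) \<in> H)" for x
  have f_eq: "f x = e" if "(x, e) \<in> H" for x e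
    unfolding f_def using linear_graph_unique[OF X E lin] that by (intro the_equality)
  have fH: "(x, f x) \<in> H" if "x \<in> carrier X" for x
    using dom[OF that] f_eq by auto
  have "f \<in> mod_hom R X E"
    by (rule mod_homI) (rule h(2)[OF fH] f_eq[OF h(4)[OF fH fH]] f_eq[OF h(5)[OF _ fH]]; assumption)+
  then show thesis
    using that f_eq GH by blast
qed

text \<open>On the submodule generated by \<open>L\<close> and \<open>x\<close>, let
  \<open>L\<close> go to 0 and \<open>x\<close> to a nonzero element \<open>u\<close> killed by the
  maximal ideal. This is well defined because every scalar that carries \<open>x\<close> into
  \<open>L\<close> lies in the maximal ideal; injectivity of \<open>E\<close> extends the map to
  \<open>X\<close>.\<close>

lemma injective_hull_separates:
  fixes R :: "('r, 's) ring_scheme"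
  assumes loc: "local_ring R" and noeth: "noetherian_ring R"
    and hull: "injective_hull R (residue_field_mod R) E"
    and X: "module R X" and L: "submodule L R X" and x: "x \<in> carrier X" "x \<notin> L"
  obtains f where "f \<in> mod_hom R X E" and "\<And>l. l \<in> L \<Longrightarrow> f l = \<zero>\<^bsub>E\<^esub>" and "f x \<noteq> \<zero>\<^bsub>E\<^esub>"
proof -
  have inj: "injective_mod R E" using hull unfolding injective_hull_def by blast
  then have E: "module R E" unfolding injective_mod_def by blast
  interpret X: module R X by fact
  interpret E: module R E by fact
  note l = submoduleD[OF X L]
  have lX: "\<And>a. a \<in> L \<Longrightarrow> a \<in> carrier X" using l(1) by blast
  obtain u where u: "u \<in> carrier E" "u \<noteq> \<zero>\<^bsub>E\<^esub>"
    and mu: "\<And>r. r \<in> max_ideal R \<Longrightarrow> r \<odot>\<^bsub>E\<^esub> u = \<zero>\<^bsub>E\<^esub>"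
    using injective_hull_socle_element[OF loc hull] by blast
  \<comment> \<open>The ideal of scalars carrying \<open>x\<close> into \<open>L\<close>. It is
    proper exactly because \<open>x\<close> lies outside \<open>L\<close>, and a proper ideal is
    contained in the maximal ideal.\<close>
  let ?J = "{r \<in> carrier R. r \<odot>\<^bsub>X\<^esub> x \<in> L}"
  have "ideal ?J R"
  proof (rule idealI[OF X.R.ring_axioms])
    show "subgroup ?J (add_monoid R)"
    proof (rule X.R.add.subgroupI)
      show "?J \<noteq> {}" using l(2) x by (auto intro!: exI[of _ "\<zero>\<^bsub>R\<^esub>"])
    next
      fix r assume "r \<in> ?J"
      then show "\<ominus>\<^bsub>R\<^esub> r \<in> ?J" using l(4) x by (simp add: X.smult_l_minus)
    next
      fix r s assume "r \<in> ?J" "s \<in> ?J"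
      then show "r \<oplus>\<^bsub>R\<^esub> s \<in> ?J" using l(3) x by (simp add: X.smult_l_distr)
    qed auto
    fix r s assume *: "r \<in> ?J" "s \<in> carrier R"
    then show "s \<otimes>\<^bsub>R\<^esub> r \<in> ?J" using l(5) x by (simp add: X.smult_assoc1)
    then show "r \<otimes>\<^bsub>R\<^esub> s \<in> ?J" using * X.R.m_comm[of r s] by simp
  qed
  moreover have "\<one>\<^bsub>R\<^esub> \<notin> ?J" using x by simp
  ultimately have J: "?J \<subseteq> max_ideal R"
    by (rule proper_ideal_subset_max_ideal[OF loc noeth])
  define G where "G = {(a \<oplus>\<^bsub>X\<^esub> r \<odot>\<^bsub>X\<^esub> x, r \<odot>\<^bsub>E\<^esub> u) | a r. a \<in> L \<and> r \<in> carrier R}"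
  have GI: "(y, e) \<in> G"
    if "a \<in> L" "r \<in> carrier R" "y = a \<oplus>\<^bsub>X\<^esub> r \<odot>\<^bsub>X\<^esub> x" "e = r \<odot>\<^bsub>E\<^esub> u" for y e a r
    using that unfolding G_def by blast
  have GE: "\<exists>a r. a \<in> L \<and> r \<in> carrier R \<and> y = a \<oplus>\<^bsub>X\<^esub> r \<odot>\<^bsub>X\<^esub> x \<and> e = r \<odot>\<^bsub>E\<^esub> u"
    if "(y, e) \<in> G" for y e
    using that unfolding G_def by blast
  have "linear_graph R X E G"
    unfolding linear_graph_def
  proof (intro conjI allI ballI impI)
    show "G \<subseteq> carrier X \<times> carrier E"
      using lX x u unfolding G_def by auto
    show "(\<zero>\<^bsub>X\<^esub>, \<zero>\<^bsub>E\<^esub>) \<in> G"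
      by (rule GI[OF l(2), of "\<zero>\<^bsub>R\<^esub>"]) (use x u in auto)
  next
    fix y e z d assume "(y, e) \<in> G \<and> (z, d) \<in> G"
    then obtain a r b s where *: "a \<in> L" "r \<in> carrier R" "b \<in> L" "s \<in> carrier R"
      and **: "y = a \<oplus>\<^bsub>X\<^esub> r \<odot>\<^bsub>X\<^esub> x" "e = r \<odot>\<^bsub>E\<^esub> u" "z = b \<oplus>\<^bsub>X\<^esub> s \<odot>\<^bsub>X\<^esub> x" "d = s \<odot>\<^bsub>E\<^esub> u"
      using GE by metis
    show "(y \<oplus>\<^bsub>X\<^esub> z, e \<oplus>\<^bsub>E\<^esub> d) \<in> G"
      by (rule GI[OF l(3)[OF *(1,3)], of "r \<oplus>\<^bsub>R\<^esub> s"])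
        (use * lX x u in \<open>simp_all add: ** X.smult_l_distr E.smult_l_distr X.M.a_ac\<close>)
  next
    fix s y e assume s: "s \<in> carrier R" and "(y, e) \<in> G"
    then obtain a r where *: "a \<in> L" "r \<in> carrier R"
      and **: "y = a \<oplus>\<^bsub>X\<^esub> r \<odot>\<^bsub>X\<^esub> x" "e = r \<odot>\<^bsub>E\<^esub> u"
      using GE by metis
    show "(s \<odot>\<^bsub>X\<^esub> y, s \<odot>\<^bsub>E\<^esub> e) \<in> G"
      by (rule GI[OF l(5)[OF s *(1)], of "s \<otimes>\<^bsub>R\<^esub> r"])
        (use * s lX x u in \<open>simp_all add: ** X.smult_r_distr X.smult_assoc1 E.smult_assoc1\<close>)
  next
    \<comment> \<open>If \<open>a\<close> plus \<open>r\<close> times \<open>x\<close> is 0 with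
      \<open>a\<close> in \<open>L\<close>, then \<open>r\<close> times \<open>x\<close> is in
      \<open>L\<close>; so \<open>r\<close> is in the maximal ideal and kills
      \<open>u\<close>.\<close>
    fix e assume "(\<zero>\<^bsub>X\<^esub>, e) \<in> G"
    then obtain a r where *: "a \<in> L" "r \<in> carrier R"
      and **: "\<zero>\<^bsub>X\<^esub> = a \<oplus>\<^bsub>X\<^esub> r \<odot>\<^bsub>X\<^esub> x" "e = r \<odot>\<^bsub>E\<^esub> u"
      using GE by metis
    have "\<ominus>\<^bsub>X\<^esub> a = r \<odot>\<^bsub>X\<^esub> x"
      using **(1) * lX x X.M.minus_equality[of "r \<odot>\<^bsub>X\<^esub> x" a] by (simp add: X.M.a_comm)
    then have "r \<odot>\<^bsub>X\<^esub> x \<in> L" using l(4)[OF *(1)] by simp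
    then have "r \<in> max_ideal R" using *(2) J by blast
    then show "e = \<zero>\<^bsub>E\<^esub>" using mu **(2) by simp
  qed
  then obtain f where f: "f \<in> mod_hom R X E" "\<And>y e. (y, e) \<in> G \<Longrightarrow> f y = e"
    using injective_mod_graph_extension[OF inj X] by blast
  show thesis
  proof (rule that[OF f(1)])
    show "f a = \<zero>\<^bsub>E\<^esub>" if "a \<in> L" for a
      by (rule f(2), rule GI[OF that, of "\<zero>\<^bsub>R\<^esub>"]) (use lX[OF that] x u in auto)
    have "f x = u"
      by (rule f(2), rule GI[OF l(2), of "\<one>\<^bsub>R\<^esub>"]) (use x u in auto)
    then show "f x \<noteq> \<zero>\<^bsub>E\<^esub>" using u by simp
  qed
qed

section \<open>Dual modules\<close>

lemma dual_mod_simps: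
  "carrier (dual_mod R E M) = mod_hom R M E \<inter> extensional (carrier M)"
  "\<zero>\<^bsub>dual_mod R E M\<^esub> = (\<lambda>x \<in> carrier M. \<zero>\<^bsub>E\<^esub>)"
  "f \<oplus>\<^bsub>dual_mod R E M\<^esub> g = (\<lambda>x \<in> carrier M. f x \<oplus>\<^bsub>E\<^esub> g x)"
  "r \<odot>\<^bsub>dual_mod R E M\<^esub> f = (\<lambda>x \<in> carrier M. r \<odot>\<^bsub>E\<^esub> f x)"
  by (simp_all add: dual_mod_def)

lemma dual_mod_carrierI:
  assumes "module R M" and "f \<in> mod_hom R M E"
  shows "restrict f (carrier M) \<in> carrier (dual_mod R E M)"
proof -
  interpret module R M by fact
  have "restrict f (carrier M) \<in> mod_hom R M E"
    by (rule mod_homI) (simp_all add: mod_homD[OF assms(2)])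
  then show ?thesis by (simp add: dual_mod_simps)
qed

lemma dual_mod_ext:
  assumes "f \<in> carrier (dual_mod R E M)" and "g \<in> carrier (dual_mod R E M)"
    and "\<And>x. x \<in> carrier M \<Longrightarrow> f x = g x"
  shows "f = g"
  using assms by (auto simp: dual_mod_simps intro: extensionalityI)

lemma dual_mod_module:
  assumes "module R E" and "module R M"
  shows "module R (dual_mod R E M)"
proof -
  interpret E: module R E by fact
  interpret M: module R M by fact
  let ?D = "dual_mod R E M"
  have hom: "f \<in> mod_hom R M E" if "f \<in> carrier ?D" for f
    using that by (simp add: dual_mod_simps)
  have val: "f x \<in> carrier E" if "f \<in> carrier ?D" "x \<in> carrier M" for f x
    using mod_homD(1)[OF hom[OF that(1)] that(2)] .
  have zero: "\<zero>\<^bsub>?D\<^esub> \<in> carrier ?D"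
    unfolding dual_mod_simps(2)
    by (rule dual_mod_carrierI[OF assms(2)], rule mod_homI) auto
  have add: "f \<oplus>\<^bsub>?D\<^esub> g \<in> carrier ?D" if "f \<in> carrier ?D" "g \<in> carrier ?D" for f g
    unfolding dual_mod_simps(3)
    by (rule dual_mod_carrierI[OF assms(2)], rule mod_homI)
      (use that val in \<open>simp_all add: mod_homD[OF hom] E.M.a_ac E.smult_r_distr\<close>)
  have smult: "r \<odot>\<^bsub>?D\<^esub> f \<in> carrier ?D" if "r \<in> carrier R" "f \<in> carrier ?D" for r f
    unfolding dual_mod_simps(4)
  proof (rule dual_mod_carrierI[OF assms(2)], rule mod_homI)
    \<comment> \<open>Linearity of a scalar multiple of \<open>f\<close> uses that two scalars
      commute on \<open>E\<close>, which comes from the commutativity of \<open>R\<close>.\<close>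
    fix s x assume sx: "s \<in> carrier R" "x \<in> carrier M"
    then have "r \<odot>\<^bsub>E\<^esub> (s \<odot>\<^bsub>E\<^esub> f x) = s \<odot>\<^bsub>E\<^esub> (r \<odot>\<^bsub>E\<^esub> f x)"
      using that val by (simp add: E.smult_assoc1[symmetric] E.R.m_comm)
    then show "r \<odot>\<^bsub>E\<^esub> f (s \<odot>\<^bsub>M\<^esub> x) = s \<odot>\<^bsub>E\<^esub> (r \<odot>\<^bsub>E\<^esub> f x)"
      using sx by (simp add: mod_homD[OF hom[OF that(2)]])
  qed (use that val in \<open>simp_all add: mod_homD[OF hom] E.smult_r_distr\<close>)
  have ev: "\<zero>\<^bsub>?D\<^esub> x = \<zero>\<^bsub>E\<^esub>" "(f \<oplus>\<^bsub>?D\<^esub> g) x = f x \<oplus>\<^bsub>E\<^esub> g x" "(r \<odot>\<^bsub>?D\<^esub> f) x = r \<odot>\<^bsub>E\<^esub> f x"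
    if "x \<in> carrier M" for x f g r
    using that by (simp_all add: dual_mod_simps)
  show ?thesis
  proof (rule moduleI[OF E.R.is_cring])
    show "abelian_group ?D"
    proof (rule abelian_groupI[OF add zero])
      fix f g h assume "f \<in> carrier ?D" "g \<in> carrier ?D" "h \<in> carrier ?D"
      then show "f \<oplus>\<^bsub>?D\<^esub> g \<oplus>\<^bsub>?D\<^esub> h = f \<oplus>\<^bsub>?D\<^esub> (g \<oplus>\<^bsub>?D\<^esub> h)"
        by (intro dual_mod_ext[of _ R E M] add) (simp_all add: ev val E.M.a_assoc)
    next
      fix f g assume "f \<in> carrier ?D" "g \<in> carrier ?D"
      then show "f \<oplus>\<^bsub>?D\<^esub> g = g \<oplus>\<^bsub>?D\<^esub> f"
        by (intro dual_mod_ext[of _ R E M] add) (simp_all add: ev val E.M.a_comm)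
    next
      fix f assume f: "f \<in> carrier ?D"
      then show "\<zero>\<^bsub>?D\<^esub> \<oplus>\<^bsub>?D\<^esub> f = f"
        by (intro dual_mod_ext[of _ R E M] add zero) (simp_all add: ev val)
      \<comment> \<open>The additive inverse of \<open>f\<close> is supplied as its multiple by -1,
        whose membership in the dual is already known.\<close>
      have n: "(\<ominus>\<^bsub>R\<^esub> \<one>\<^bsub>R\<^esub>) \<odot>\<^bsub>?D\<^esub> f \<in> carrier ?D"
        using f by (intro smult) simp_all
      have "(\<ominus>\<^bsub>R\<^esub> \<one>\<^bsub>R\<^esub>) \<odot>\<^bsub>?D\<^esub> f \<oplus>\<^bsub>?D\<^esub> f = \<zero>\<^bsub>?D\<^esub>"
        using f n by (intro dual_mod_ext[of _ R E M] add zero) (simp_all add: ev val E.smult_l_minus E.M.l_neg)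
      with n show "\<exists>g\<in>carrier ?D. g \<oplus>\<^bsub>?D\<^esub> f = \<zero>\<^bsub>?D\<^esub>" by blast
    qed
  next
    fix r s f assume "r \<in> carrier R" "s \<in> carrier R" "f \<in> carrier ?D"
    then show "(r \<oplus>\<^bsub>R\<^esub> s) \<odot>\<^bsub>?D\<^esub> f = r \<odot>\<^bsub>?D\<^esub> f \<oplus>\<^bsub>?D\<^esub> s \<odot>\<^bsub>?D\<^esub> f"
      by (intro dual_mod_ext[of _ R E M] smult add) (simp_all add: ev val E.smult_l_distr)
  next
    fix r f g assume "r \<in> carrier R" "f \<in> carrier ?D" "g \<in> carrier ?D"
    then show "r \<odot>\<^bsub>?D\<^esub> (f \<oplus>\<^bsub>?D\<^esub> g) = r \<odot>\<^bsub>?D\<^esub> f \<oplus>\<^bsub>?D\<^esub> r \<odot>\<^bsub>?D\<^esub> g"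
      by (intro dual_mod_ext[of _ R E M] smult add) (simp_all add: ev val E.smult_r_distr)
  next
    fix r s f assume "r \<in> carrier R" "s \<in> carrier R" "f \<in> carrier ?D"
    then show "(r \<otimes>\<^bsub>R\<^esub> s) \<odot>\<^bsub>?D\<^esub> f = r \<odot>\<^bsub>?D\<^esub> (s \<odot>\<^bsub>?D\<^esub> f)"
      by (intro dual_mod_ext[of _ R E M] smult) (simp_all add: ev val E.smult_assoc1)
  next
    fix f assume "f \<in> carrier ?D"
    then show "\<one>\<^bsub>R\<^esub> \<odot>\<^bsub>?D\<^esub> f = f"
      by (intro dual_mod_ext[of _ R E M] smult) (simp_all add: ev val)
  qed (rule smult)
qed

lemma dual_mod_hom:
  assumes "f \<in> carrier (dual_mod R E M)"
  shows "f \<in> mod_hom R M E"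
  using assms by (simp add: dual_mod_simps)

text \<open>Negation in the dual is an inverse in its additive group and carries no pointwise
  formula of its own; written as the scalar -1 it can be evaluated.\<close>

lemma dual_mod_minus:
  assumes "module R E" and "module R M" and "f \<in> carrier (dual_mod R E M)" and "x \<in> carrier M"
  shows "(\<ominus>\<^bsub>dual_mod R E M\<^esub> f) x = \<ominus>\<^bsub>E\<^esub> f x"
proof -
  interpret E: module R E by fact
  interpret D: module R "dual_mod R E M" by (rule dual_mod_module[OF assms(1,2)])
  have "\<ominus>\<^bsub>dual_mod R E M\<^esub> f = (\<ominus>\<^bsub>R\<^esub> \<one>\<^bsub>R\<^esub>) \<odot>\<^bsub>dual_mod R E M\<^esub> f"
    using assms(3) by (simp add: D.smult_l_minus)
  then show ?thesis
    using assms(4) mod_homD(1)[OF dual_mod_hom[OF assms(3)] assms(4)]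
    by (simp add: dual_mod_simps(4) E.smult_l_minus)
qed

lemma dual_eval_closed:
  assumes "module R E" and "module R M" and "x \<in> carrier M"
  shows "dual_eval R E M x \<in> carrier (dual_mod R E (dual_mod R E M))"
  unfolding dual_eval_def
  by (rule dual_mod_carrierI[OF dual_mod_module[OF assms(1,2)]], rule mod_homI)
    (use assms(3) mod_homD(1)[OF dual_mod_hom] in \<open>auto simp: dual_mod_simps(3,4)\<close>)

lemma mod_isoI:
  assumes "f \<in> mod_hom R M N"
    and "\<And>x y. x \<in> carrier M \<Longrightarrow> y \<in> carrier M \<Longrightarrow> f x = f y \<Longrightarrow> x = y"
    and "\<And>y. y \<in> carrier N \<Longrightarrow> \<exists>x\<in>carrier M. f x = y"
  shows "f \<in> mod_iso R M N"
proof -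
  have "f ` carrier M = carrier N"
    using mod_homD(1)[OF assms(1)] assms(3) by blast
  moreover have "inj_on f (carrier M)" using assms(2) by (auto intro: inj_onI)
  ultimately show ?thesis using assms(1) by (simp add: mod_iso_def bij_betw_def)
qed

section \<open>Maps killing a submodule, and duals of quotients and of isomorphic modules\<close>

lemma quot_dual_submodule:
  assumes "module R E" and "module R M" and "C \<subseteq> carrier M"
  shows "submodule (quot_dual R E M C) R (dual_mod R E M)"
proof -
  interpret E: module R E by fact
  interpret D: module R "dual_mod R E M" by (rule dual_mod_module[OF assms(1,2)])
  have C: "c \<in> carrier M" if "c \<in> C" for c using that assms(3) by blast
  show ?thesis
  proof (rule D.submoduleI)
    fix f assume f: "f \<in> quot_dual R E M C"
    then show "\<ominus>\<^bsub>dual_mod R E M\<^esub> f \<in> quot_dual R E M C"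
      using dual_mod_minus[OF assms(1,2)] C by (auto simp: quot_dual_def)
  next
    fix f g assume "f \<in> quot_dual R E M C" "g \<in> quot_dual R E M C"
    then show "f \<oplus>\<^bsub>dual_mod R E M\<^esub> g \<in> quot_dual R E M C"
      using D.M.a_closed[of f g] C by (simp add: quot_dual_def) (simp add: dual_mod_simps(3))
  next
    fix r f assume "r \<in> carrier R" "f \<in> quot_dual R E M C"
    then show "r \<odot>\<^bsub>dual_mod R E M\<^esub> f \<in> quot_dual R E M C"
      using D.smult_closed[of r f] C by (simp add: quot_dual_def) (simp add: dual_mod_simps(4))
  next
    show "\<zero>\<^bsub>dual_mod R E M\<^esub> \<in> quot_dual R E M C"
      using D.M.zero_closed C by (simp add: quot_dual_def) (simp add: dual_mod_simps(2))
  qed (simp add: quot_dual_def)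
qed

text \<open>Pulling back along the quotient map is injective since every coset has a representative,
  and it reaches every map killing \<open>L\<close> since such a map is constant on cosets. This is
  the identification of \<open>(M/L)\<^sup>\<or>\<close> with
  \<open>quot_dual R E M L\<close>.\<close>

lemma dual_quot_mod_iso:
  assumes E: "module R E" and M: "module R M" and L: "submodule L R M"
  shows "(\<lambda>g. \<lambda>x\<in>carrier M. g (L +>\<^bsub>M\<^esub> x)) \<in>
    mod_iso R (dual_mod R E (quot_mod M L)) (sub_mod (dual_mod R E M) (quot_dual R E M L))"
    (is "?t \<in> mod_iso R ?Q ?S")
proof -
  interpret E: module R E by fact
  interpret M: module R M by fact
  have Q: "module R (quot_mod M L)" by (rule quot_mod_module[OF M L])
  have c: "L +>\<^bsub>M\<^esub> x \<in> carrier (quot_mod M L)" if "x \<in> carrier M" for x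
    using that by (simp add: quot_mod_carrier)
  have LM: "L \<subseteq> carrier M" by (rule submoduleD(1)[OF M L])
  have L0: "L +>\<^bsub>M\<^esub> l = L" if "l \<in> L" for l
    using that LM L M.a_coset_join2 submodule.axioms(1) by blast
  show ?thesis
  proof (rule mod_isoI)
    show "?t \<in> mod_hom R ?Q ?S"
    proof (rule mod_homI)
      fix g assume g: "g \<in> carrier ?Q"
      note h = mod_homD[OF dual_mod_hom[OF g]]
      have "?t g \<in> carrier (dual_mod R E M)"
      proof (rule dual_mod_carrierI[OF M], rule mod_homI)
        show "g (L +>\<^bsub>M\<^esub> (x \<oplus>\<^bsub>M\<^esub> y)) = g (L +>\<^bsub>M\<^esub> x) \<oplus>\<^bsub>E\<^esub> g (L +>\<^bsub>M\<^esub> y)"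
          if "x \<in> carrier M" "y \<in> carrier M" for x y
          using h(2)[OF c c] quot_mod_add[OF M L] that by simp
        show "g (L +>\<^bsub>M\<^esub> (r \<odot>\<^bsub>M\<^esub> x)) = r \<odot>\<^bsub>E\<^esub> g (L +>\<^bsub>M\<^esub> x)"
          if "r \<in> carrier R" "x \<in> carrier M" for r x
          using h(3)[OF _ c] quot_mod_smult[OF M L] that by simp
      qed (rule h(1)[OF c])
      moreover have "?t g l = \<zero>\<^bsub>E\<^esub>" if "l \<in> L" for l
      proof -
        have "g L = \<zero>\<^bsub>E\<^esub>"
          using mod_hom_zero[OF Q E dual_mod_hom[OF g]] by (simp add: quot_mod_def)
        then show ?thesis using that LM L0 by auto
      qed
      ultimately show "?t g \<in> carrier ?S" by (simp add: quot_dual_def)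
    next
      fix g h assume "g \<in> carrier ?Q" "h \<in> carrier ?Q"
      show "?t (g \<oplus>\<^bsub>?Q\<^esub> h) = ?t g \<oplus>\<^bsub>?S\<^esub> ?t h"
        by (auto simp: dual_mod_simps(3) c)
    next
      fix r g assume "r \<in> carrier R" "g \<in> carrier ?Q"
      show "?t (r \<odot>\<^bsub>?Q\<^esub> g) = r \<odot>\<^bsub>?S\<^esub> ?t g"
        by (auto simp: dual_mod_simps(4) c)
    qed
  next
    fix g h assume g: "g \<in> carrier ?Q" and h: "h \<in> carrier ?Q" and eq: "?t g = ?t h"
    show "g = h"
    proof (rule dual_mod_ext[OF g h])
      fix U assume "U \<in> carrier (quot_mod M L)"
      then obtain x where "x \<in> carrier M" "U = L +>\<^bsub>M\<^esub> x" by (auto simp: quot_mod_carrier)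
      then show "g U = h U" using fun_cong[OF eq, of x] by simp
    qed
  next
    fix f assume "f \<in> carrier ?S"
    then have f: "f \<in> carrier (dual_mod R E M)" and fL: "\<And>l. l \<in> L \<Longrightarrow> f l = \<zero>\<^bsub>E\<^esub>"
      by (auto simp: quot_dual_def)
    note h = mod_homD[OF dual_mod_hom[OF f]]
    \<comment> \<open>The value on a coset is read off at an arbitrarily chosen representative. The
      next claim shows that the choice does not matter, because two representatives differ by an
      element of \<open>L\<close>, which \<open>f\<close> kills.\<close>
    define g where "g U = f (SOME x. x \<in> carrier M \<and> U = L +>\<^bsub>M\<^esub> x)" for U
    have g: "g (L +>\<^bsub>M\<^esub> x) = f x" if x: "x \<in> carrier M" for x
    proof -
      define y where "y = (SOME y. y \<in> carrier M \<and> L +>\<^bsub>M\<^esub> x = L +>\<^bsub>M\<^esub> y)"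
      have y: "y \<in> carrier M \<and> L +>\<^bsub>M\<^esub> x = L +>\<^bsub>M\<^esub> y"
        unfolding y_def by (rule someI[of _ x]) (use x in simp)
      then obtain l where l: "l \<in> L" "y = l \<oplus>\<^bsub>M\<^esub> x"
        using coset_eq_iff[OF M L, of y x] x by auto
      then have "f y = f x" using h(1,2) fL x LM by auto
      then show ?thesis unfolding g_def y_def by simp
    qed
    have "g \<in> mod_hom R (quot_mod M L) E"
    proof (rule mod_homI)
      fix U V assume "U \<in> carrier (quot_mod M L)" "V \<in> carrier (quot_mod M L)"
      then obtain x y where "x \<in> carrier M" "U = L +>\<^bsub>M\<^esub> x" "y \<in> carrier M" "V = L +>\<^bsub>M\<^esub> y"
        by (auto simp: quot_mod_carrier)
      then show "g (U \<oplus>\<^bsub>quot_mod M L\<^esub> V) = g U \<oplus>\<^bsub>E\<^esub> g V"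
        by (simp add: quot_mod_add[OF M L] g h)
    next
      fix r U assume "r \<in> carrier R" "U \<in> carrier (quot_mod M L)"
      then obtain x where "r \<in> carrier R" "x \<in> carrier M" "U = L +>\<^bsub>M\<^esub> x"
        by (auto simp: quot_mod_carrier)
      then show "g (r \<odot>\<^bsub>quot_mod M L\<^esub> U) = r \<odot>\<^bsub>E\<^esub> g U"
        by (simp add: quot_mod_smult[OF M L] g h)
    qed (auto simp: quot_mod_carrier g h)
    then have "restrict g (carrier (quot_mod M L)) \<in> carrier ?Q"
      by (rule dual_mod_carrierI[OF Q])
    moreover have "?t (restrict g (carrier (quot_mod M L))) = f"
      using f by (auto simp: c g dual_mod_simps(1) extensional_def)
    ultimately show "\<exists>g\<in>carrier ?Q. ?t g = f" by blast
  qed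
qed

text \<open>Contravariance of the dual: precomposition with \<open>f\<close> has precomposition with
  the inverse of \<open>f\<close> as its inverse. It serves to replace a quotient by its isomorphic
  copy in the class.\<close>

lemma dual_mod_iso:
  assumes M: "module R M" and N: "module R N" and f: "f \<in> mod_iso R M N"
  shows "(\<lambda>g. \<lambda>x\<in>carrier M. g (f x)) \<in> mod_iso R (dual_mod R E N) (dual_mod R E M)"
    (is "?t \<in> _")
proof -
  have hom: "f \<in> mod_hom R M N" and bij: "bij_betw f (carrier M) (carrier N)"
    using f by (auto simp: mod_iso_def)
  note fh = mod_homD[OF hom]
  have surj: "\<exists>x\<in>carrier M. y = f x" if "y \<in> carrier N" for y
    using that bij by (auto simp: bij_betw_def)
  have g_hom: "inv_into (carrier M) f \<in> mod_hom R N M"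
    using mod_iso_inv[OF M f] by (simp add: mod_iso_def)
  have gf: "inv_into (carrier M) f (f x) = x" if "x \<in> carrier M" for x
    using that bij by (auto simp: bij_betw_def)
  show ?thesis
  proof (rule mod_isoI)
    show "?t \<in> mod_hom R (dual_mod R E N) (dual_mod R E M)"
    proof (rule mod_homI)
      fix g assume "g \<in> carrier (dual_mod R E N)"
      note h = mod_homD[OF dual_mod_hom[OF this]]
      show "?t g \<in> carrier (dual_mod R E M)"
        by (rule dual_mod_carrierI[OF M], rule mod_homI) (simp_all add: h fh)
    qed (auto simp: dual_mod_simps(3,4) fh(1))
  next
    fix g h assume gh: "g \<in> carrier (dual_mod R E N)" "h \<in> carrier (dual_mod R E N)" and eq: "?t g = ?t h"
    show "g = h"
    proof (rule dual_mod_ext[OF gh])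
      fix y assume "y \<in> carrier N"
      then obtain x where "x \<in> carrier M" "y = f x" using surj by blast
      then show "g y = h y" using fun_cong[OF eq, of x] by simp
    qed
  next
    fix k assume k: "k \<in> carrier (dual_mod R E M)"
    note kh = mod_homD[OF dual_mod_hom[OF k]] and ih = mod_homD[OF g_hom]
    let ?g = "\<lambda>y\<in>carrier N. k (inv_into (carrier M) f y)"
    have "?g \<in> carrier (dual_mod R E N)"
      by (rule dual_mod_carrierI[OF N], rule mod_homI) (simp_all add: kh ih)
    moreover have "?t ?g = k"
      using k by (auto simp: fh(1) gf dual_mod_simps(1) extensional_def)
    ultimately show "\<exists>g\<in>carrier (dual_mod R E N). ?t g = k" by blast
  qed
qed

section \<open>Annihilators and closures\<close>

text \<open>A point \<open>b\<close> outside \<open>C\<close> is separated from \<open>C\<close> by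
  a map to \<open>E\<close>; restricted to the carrier, that map belongs to
  \<open>quot_dual R E B C\<close> and does not vanish at \<open>b\<close>.\<close>

lemma quot_dual_annihilator:
  assumes loc: "local_ring R" and noeth: "noetherian_ring R"
    and hull: "injective_hull R (residue_field_mod R) E"
    and B: "module R B" and C: "submodule C R B"
  shows "{b \<in> carrier B. \<forall>f \<in> quot_dual R E B C. f b = \<zero>\<^bsub>E\<^esub>} = C"
proof
  show "C \<subseteq> {b \<in> carrier B. \<forall>f \<in> quot_dual R E B C. f b = \<zero>\<^bsub>E\<^esub>}"
    using submoduleD(1)[OF B C] by (auto simp: quot_dual_def)
  show "{b \<in> carrier B. \<forall>f \<in> quot_dual R E B C. f b = \<zero>\<^bsub>E\<^esub>} \<subseteq> C"
  proof (rule subsetI, rule ccontr)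
    fix b assume b: "b \<in> {b \<in> carrier B. \<forall>f \<in> quot_dual R E B C. f b = \<zero>\<^bsub>E\<^esub>}" and "b \<notin> C"
    then obtain f where f: "f \<in> mod_hom R B E" "\<And>c. c \<in> C \<Longrightarrow> f c = \<zero>\<^bsub>E\<^esub>" "f b \<noteq> \<zero>\<^bsub>E\<^esub>"
      using injective_hull_separates[OF loc noeth hull B C, of b] by blast
    have "restrict f (carrier B) \<in> quot_dual R E B C"
      using dual_mod_carrierI[OF B f(1)] f(2) submoduleD(1)[OF B C] by (auto simp: quot_dual_def)
    then show False using b f(3) by fastforce
  qed
qed

text \<open>A smaller set of maps has a larger annihilator, and the annihilators of the two sets are
  \<open>D\<close> and \<open>C\<close>. The equivalence yields both the order reversal and the
  injectivity of \<open>quot_dual R E B\<close> on submodules.\<close>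

lemma quot_dual_subset_iff:
  assumes "local_ring R" and "noetherian_ring R" and "injective_hull R (residue_field_mod R) E"
    and "module R B" and "submodule C R B" and "submodule D R B"
  shows "quot_dual R E B D \<subseteq> quot_dual R E B C \<longleftrightarrow> C \<subseteq> D"
proof
  assume "quot_dual R E B D \<subseteq> quot_dual R E B C"
  then show "C \<subseteq> D"
    using quot_dual_annihilator[OF assms(1-4), OF assms(5)]
      quot_dual_annihilator[OF assms(1-4), OF assms(6)] by blast
qed (auto simp: quot_dual_def)

lemma annihilator_submodule:
  assumes "module R E" and "module R B" and "L \<subseteq> carrier (dual_mod R E B)"
  shows "submodule {b \<in> carrier B. \<forall>f \<in> L. f b = \<zero>\<^bsub>E\<^esub>} R B"
proof -
  interpret E: module R E by fact
  interpret B: module R B by fact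
  have hom: "f \<in> mod_hom R B E" if "f \<in> L" for f using that assms(3) dual_mod_hom by blast
  note h = mod_homD[OF hom]
  show ?thesis
  proof (rule B.submoduleI)
    show "\<zero>\<^bsub>B\<^esub> \<in> {b \<in> carrier B. \<forall>f \<in> L. f b = \<zero>\<^bsub>E\<^esub>}"
      using mod_hom_zero[OF assms(2,1) hom] by simp
    fix b assume b: "b \<in> {b \<in> carrier B. \<forall>f \<in> L. f b = \<zero>\<^bsub>E\<^esub>}"
    have "f (\<ominus>\<^bsub>B\<^esub> b) = \<zero>\<^bsub>E\<^esub>" if "f \<in> L" for f
    proof -
      have "b \<in> carrier B" and fb: "f b = \<zero>\<^bsub>E\<^esub>" using b that by auto
      then have "f (\<ominus>\<^bsub>B\<^esub> b) = (\<ominus>\<^bsub>R\<^esub> \<one>\<^bsub>R\<^esub>) \<odot>\<^bsub>E\<^esub> f b"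
        using h(3)[OF that, of "\<ominus>\<^bsub>R\<^esub> \<one>\<^bsub>R\<^esub>" b] by (simp add: B.smult_l_minus)
      then show ?thesis unfolding fb by simp
    qed
    then show "\<ominus>\<^bsub>B\<^esub> b \<in> {b \<in> carrier B. \<forall>f \<in> L. f b = \<zero>\<^bsub>E\<^esub>}"
      using b by simp
    fix r assume r: "r \<in> carrier R"
    have "f (r \<odot>\<^bsub>B\<^esub> b) = \<zero>\<^bsub>E\<^esub>" if "f \<in> L" for f
    proof -
      have "b \<in> carrier B" and fb: "f b = \<zero>\<^bsub>E\<^esub>" using b that by auto
      then show ?thesis using h(3)[OF that r, of b] r unfolding fb by simp
    qed
    then show "r \<odot>\<^bsub>B\<^esub> b \<in> {b \<in> carrier B. \<forall>f \<in> L. f b = \<zero>\<^bsub>E\<^esub>}"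
      using b r by simp
  qed (simp_all add: h subset_iff)
qed

section \<open>Submodules of the dual of a Matlis-dualizable module\<close>

lemma matlis_dualizableD:
  assumes "matlis_dualizable R E M"
  shows "module R M" and "dual_eval R E M \<in> mod_hom R M (dual_mod R E (dual_mod R E M))"
    and "\<And>x y. x \<in> carrier M \<Longrightarrow> y \<in> carrier M \<Longrightarrow> dual_eval R E M x = dual_eval R E M y \<Longrightarrow> x = y"
    and "\<And>\<phi>. \<phi> \<in> carrier (dual_mod R E (dual_mod R E M)) \<Longrightarrow>
      \<exists>x\<in>carrier M. \<forall>f\<in>carrier (dual_mod R E M). \<phi> f = f x"
proof -
  have bij: "bij_betw (dual_eval R E M) (carrier M) (carrier (dual_mod R E (dual_mod R E M)))"
    using assms by (auto simp: matlis_dualizable_def mod_iso_def)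
  show "module R M" "dual_eval R E M \<in> mod_hom R M (dual_mod R E (dual_mod R E M))"
    using assms by (auto simp: matlis_dualizable_def mod_iso_def)
  show "\<And>x y. x \<in> carrier M \<Longrightarrow> y \<in> carrier M \<Longrightarrow> dual_eval R E M x = dual_eval R E M y \<Longrightarrow> x = y"
    using bij by (auto simp: bij_betw_def dest: inj_onD)
  fix \<phi> assume "\<phi> \<in> carrier (dual_mod R E (dual_mod R E M))"
  then obtain x where "x \<in> carrier M" "\<phi> = dual_eval R E M x"
    using bij by (auto simp: bij_betw_def)
  then show "\<exists>x\<in>carrier M. \<forall>f\<in>carrier (dual_mod R E M). \<phi> f = f x"
    by (auto simp: dual_eval_def)
qed

text \<open>Separation is applied inside the dual of \<open>B\<close>, not inside \<open>B\<close>: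
  a functional that vanishes on \<open>L\<close> but not at \<open>g\<close> is evaluation at some
  point of \<open>B\<close>, and that point annihilates \<open>L\<close> but not
  \<open>g\<close>.\<close>

lemma quot_dual_of_annihilator:
  assumes loc: "local_ring R" and noeth: "noetherian_ring R"
    and hull: "injective_hull R (residue_field_mod R) E"
    and B: "matlis_dualizable R E B" and L: "submodule L R (dual_mod R E B)"
  shows "quot_dual R E B {b \<in> carrier B. \<forall>f \<in> L. f b = \<zero>\<^bsub>E\<^esub>} = L"
proof
  let ?D = "dual_mod R E B"
  have E: "module R E" using hull by (simp add: injective_hull_def injective_mod_def)
  have D: "module R ?D" by (rule dual_mod_module[OF E matlis_dualizableD(1)[OF B]])
  have LD: "L \<subseteq> carrier ?D" by (rule submoduleD(1)[OF D L])
  then show "L \<subseteq> quot_dual R E B {b \<in> carrier B. \<forall>f \<in> L. f b = \<zero>\<^bsub>E\<^esub>}"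
    by (auto simp: quot_dual_def)
  show "quot_dual R E B {b \<in> carrier B. \<forall>f \<in> L. f b = \<zero>\<^bsub>E\<^esub>} \<subseteq> L"
  proof (rule subsetI, rule ccontr)
    fix g assume g: "g \<in> quot_dual R E B {b \<in> carrier B. \<forall>f \<in> L. f b = \<zero>\<^bsub>E\<^esub>}" and "g \<notin> L"
    then have gD: "g \<in> carrier ?D" by (simp add: quot_dual_def)
    then obtain \<phi> where \<phi>: "\<phi> \<in> mod_hom R ?D E" "\<And>f. f \<in> L \<Longrightarrow> \<phi> f = \<zero>\<^bsub>E\<^esub>" "\<phi> g \<noteq> \<zero>\<^bsub>E\<^esub>"
      using injective_hull_separates[OF loc noeth hull D L, of g] \<open>g \<notin> L\<close> by blast
    \<comment> \<open>Dualizability enters here: the separating functional is represented by a point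
      \<open>b\<close> of \<open>B\<close>.\<close>
    obtain b where b: "b \<in> carrier B" "\<forall>f\<in>carrier ?D. \<phi> f = f b"
      using matlis_dualizableD(4)[OF B dual_mod_carrierI[OF D \<phi>(1)]] by auto
    then have "\<forall>f\<in>L. f b = \<zero>\<^bsub>E\<^esub>" using \<phi>(2) LD by (metis subsetD)
    then have "g b = \<zero>\<^bsub>E\<^esub>" using g b(1) by (simp add: quot_dual_def)
    then show False using \<phi>(3) b(2) gD by simp
  qed
qed

text \<open>Both modules are identified with the functionals on \<open>B\<^sup>\<or>\<close> that
  kill \<open>(B/C)\<^sup>\<or>\<close>: the dual of the quotient by pullback, and \<open>C\<close>
  by evaluation. The second conclusion records that \<psi> represents a functional on the quotient
  by the point of \<open>C\<close> at which it evaluates.\<close>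

lemma dual_quot_quot_dual_iso:
  assumes loc: "local_ring R" and noeth: "noetherian_ring R"
    and hull: "injective_hull R (residue_field_mod R) E"
    and B: "matlis_dualizable R E B" and C: "submodule C R B"
  obtains \<psi> where "\<psi> \<in> mod_iso R (dual_mod R E (quot_mod (dual_mod R E B) (quot_dual R E B C))) (sub_mod B C)"
    and "\<And>\<phi> f. \<phi> \<in> carrier (dual_mod R E (quot_mod (dual_mod R E B) (quot_dual R E B C))) \<Longrightarrow>
      f \<in> carrier (dual_mod R E B) \<Longrightarrow> f (\<psi> \<phi>) = \<phi> (quot_dual R E B C +>\<^bsub>dual_mod R E B\<^esub> f)"
proof -
  let ?D = "dual_mod R E B" and ?L = "quot_dual R E B C"
  let ?S = "sub_mod (dual_mod R E ?D) (quot_dual R E ?D ?L)"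
  have E: "module R E" using hull by (simp add: injective_hull_def injective_mod_def)
  note b = matlis_dualizableD[OF B]
  have CB: "c \<in> carrier B" if "c \<in> C" for c using that submoduleD(1)[OF b(1) C] by blast
  have D: "module R ?D" by (rule dual_mod_module[OF E b(1)])
  have L: "submodule ?L R ?D"
    by (rule quot_dual_submodule[OF E b(1) submoduleD(1)[OF b(1) C]])
  have ev: "dual_eval R E B x f = f x" if "f \<in> carrier ?D" for x f
    using that by (simp add: dual_eval_def)
  have LD: "f \<in> carrier ?D" if "f \<in> ?L" for f using that by (simp add: quot_dual_def)
  \<comment> \<open>Every functional on the dual is evaluation at a point \<open>x\<close>. It kills
    \<open>?L\<close> exactly when \<open>x\<close> is annihilated by all of \<open>?L\<close>, that
    is, when \<open>x\<close> lies in \<open>C\<close>.\<close>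
  have \<sigma>: "dual_eval R E B \<in> mod_iso R (sub_mod B C) ?S"
  proof (rule mod_isoI)
    show "dual_eval R E B \<in> mod_hom R (sub_mod B C) ?S"
    proof (rule mod_homI)
      fix c assume c: "c \<in> carrier (sub_mod B C)"
      then have "dual_eval R E B c f = \<zero>\<^bsub>E\<^esub>" if "f \<in> ?L" for f
        using that ev[OF LD[OF that]] by (simp add: quot_dual_def)
      then show "dual_eval R E B c \<in> carrier ?S"
        using c mod_homD(1)[OF b(2)] CB by (simp add: quot_dual_def[of R E ?D])
    qed (use mod_homD[OF b(2)] CB in simp_all)
    fix \<phi> assume "\<phi> \<in> carrier ?S"
    then have \<phi>: "\<phi> \<in> carrier (dual_mod R E ?D)" "\<And>f. f \<in> ?L \<Longrightarrow> \<phi> f = \<zero>\<^bsub>E\<^esub>"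
      by (auto simp: quot_dual_def[of R E ?D])
    obtain x where x: "x \<in> carrier B" "\<forall>f\<in>carrier ?D. \<phi> f = f x"
      using b(4)[OF \<phi>(1)] by blast
    have "\<forall>f\<in>?L. f x = \<zero>\<^bsub>E\<^esub>" using \<phi>(2) x(2) LD by simp
    then have "x \<in> C"
      using quot_dual_annihilator[OF loc noeth hull b(1) C] x(1) by blast
    moreover have "dual_eval R E B x = \<phi>"
      by (rule dual_mod_ext[OF dual_eval_closed[OF E b(1) x(1)] \<phi>(1)]) (use x ev in simp)
    ultimately show "\<exists>c\<in>carrier (sub_mod B C). dual_eval R E B c = \<phi>" by auto
  qed (use b(3) CB in simp)
  have SC: "module R (sub_mod B C)" by (rule submodule.submodule_is_module[OF C b(1)])
  let ?t = "\<lambda>\<phi>. \<lambda>f\<in>carrier ?D. \<phi> (?L +>\<^bsub>?D\<^esub> f)"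
  let ?s = "inv_into (carrier (sub_mod B C)) (dual_eval R E B)"
  have t: "?t \<in> mod_iso R (dual_mod R E (quot_mod ?D ?L)) ?S"
    by (rule dual_quot_mod_iso[OF E D L])
  show thesis
  proof (rule that)
    show "?s \<circ> ?t \<in> mod_iso R (dual_mod R E (quot_mod ?D ?L)) (sub_mod B C)"
      by (rule mod_iso_comp[OF t mod_iso_inv[OF SC \<sigma>]])
    fix \<phi> f assume \<phi>: "\<phi> \<in> carrier (dual_mod R E (quot_mod ?D ?L))" and f: "f \<in> carrier ?D"
    have "?t \<in> mod_hom R (dual_mod R E (quot_mod ?D ?L)) ?S"
      using t by (simp only: mod_iso_def mem_Collect_eq)
    from mod_homD(1)[OF this \<phi>] have "?t \<phi> \<in> dual_eval R E B ` carrier (sub_mod B C)"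
      using \<sigma> by (simp only: mod_iso_def bij_betw_def mem_Collect_eq)
    from f_inv_into_f[OF this] have "dual_eval R E B (?s (?t \<phi>)) = ?t \<phi>" .
    then have "dual_eval R E B (?s (?t \<phi>)) f = \<phi> (?L +>\<^bsub>?D\<^esub> f)"
      using f by (metis restrict_apply')
    then show "f ((?s \<circ> ?t) \<phi>) = \<phi> (?L +>\<^bsub>?D\<^esub> f)"
      using ev[OF f] by simp
  qed
qed

text \<open>Two isomorphisms from \<open>X\<close> to members of the class differ by an isomorphism
  between those members, which the selector respects. Hence one convenient \<psi> suffices to
  compute the value.\<close>

lemma selector_upto_iso_eq:
  assumes sel: "submodule_selector R \<M> i" and X: "module R X"
    and N: "N \<in> \<M>" and \<psi>: "\<psi> \<in> mod_iso R X N"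
  shows "selector_upto_iso R \<M> i X = {x \<in> carrier X. \<psi> x \<in> i N}"
proof -
  have "\<psi> x \<in> i N" if x: "x \<in> carrier X" and M: "M \<in> \<M>" and \<phi>: "\<phi> \<in> mod_iso R X M" and "\<phi> x \<in> i M" for x M \<phi>
  proof -
    have iso: "\<psi> \<circ> inv_into (carrier X) \<phi> \<in> mod_iso R M N"
      by (rule mod_iso_comp[OF mod_iso_inv[OF X \<phi>] \<psi>])
    then have "(\<psi> \<circ> inv_into (carrier X) \<phi>) ` i M = i N"
      using sel M N unfolding submodule_selector_def by blast
    moreover have "inv_into (carrier X) \<phi> (\<phi> x) = x"
      using \<phi> x by (auto simp: mod_iso_def bij_betw_def)
    ultimately show ?thesis using \<open>\<phi> x \<in> i M\<close> by force
  qed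
  then show ?thesis
    using N \<psi> unfolding selector_upto_iso_def by blast
qed

text \<open>A map \<open>f\<close> is in the closure iff its coset is killed by every functional in
  the interior of the dual of the quotient. Under \<psi> these functionals correspond to the points
  \<open>c\<close> of \<open>?I\<close>, and their values at the coset become the values
  \<open>f c\<close>; so the condition is that \<open>f\<close> kills \<open>?I\<close>.\<close>

lemma residual_closure_quot_dual:
  assumes loc: "local_ring R" and noeth: "noetherian_ring R"
    and hull: "injective_hull R (residue_field_mod R) E"
    and sel: "submodule_selector R \<M> i"
    and B: "matlis_dualizable R E B" and C: "submodule C R B" and CM: "sub_mod B C \<in> \<M>"
  shows "residual_closure (dual_selector R E \<M> i) (dual_mod R E B) (quot_dual R E B C) =
    quot_dual R E B (i (sub_mod B C))"
proof -
  let ?D = "dual_mod R E B" and ?L = "quot_dual R E B C"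
  let ?N = "quot_mod ?D ?L" and ?I = "i (sub_mod B C)"
  have E: "module R E" using hull by (simp add: injective_hull_def injective_mod_def)
  note b = matlis_dualizableD[OF B]
  have D: "module R ?D" by (rule dual_mod_module[OF E b(1)])
  have L: "submodule ?L R ?D"
    by (rule quot_dual_submodule[OF E b(1) submoduleD(1)[OF b(1) C]])
  have N: "module R ?N" by (rule quot_mod_module[OF D L])
  have N': "module R (dual_mod R E ?N)" by (rule dual_mod_module[OF E N])
  obtain \<psi> where \<psi>: "\<psi> \<in> mod_iso R (dual_mod R E ?N) (sub_mod B C)"
    and \<psi>_eq: "\<And>\<phi> f. \<phi> \<in> carrier (dual_mod R E ?N) \<Longrightarrow> f \<in> carrier ?D \<Longrightarrow> f (\<psi> \<phi>) = \<phi> (?L +>\<^bsub>?D\<^esub> f)"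
    using dual_quot_quot_dual_iso[OF loc noeth hull B C] by blast
  have \<psi>_surj: "\<psi> ` carrier (dual_mod R E ?N) = C"
    using \<psi> by (auto simp: mod_iso_def bij_betw_def)
  have "?I \<subseteq> C"
    using sel CM submoduleD(1)[OF submodule.submodule_is_module[OF C b(1)], of ?I]
    by (simp add: submodule_selector_def)
  \<comment> \<open>Each point of \<open>?I\<close> comes from a functional, so quantifying over
    functionals with \<psi>-image in \<open>?I\<close> amounts to quantifying over \<open>?I\<close>
    itself.\<close>
  then have \<psi>_I: "\<exists>\<phi>\<in>carrier (dual_mod R E ?N). \<psi> \<phi> = c" if "c \<in> ?I" for c
  proof -
    have "c \<in> \<psi> ` carrier (dual_mod R E ?N)"
      using \<psi>_surj subsetD[OF \<open>?I \<subseteq> C\<close> that] by simp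
    then show ?thesis by (elim imageE) (rule bexI, rule sym)
  qed
  have S: "selector_upto_iso R \<M> i (dual_mod R E ?N) = {\<phi> \<in> carrier (dual_mod R E ?N). \<psi> \<phi> \<in> ?I}"
    by (rule selector_upto_iso_eq[OF sel N' CM \<psi>])
  have "?L +>\<^bsub>?D\<^esub> f \<in> dual_selector R E \<M> i ?N \<longleftrightarrow> (\<forall>c\<in>?I. f c = \<zero>\<^bsub>E\<^esub>)" if f: "f \<in> carrier ?D" for f
  proof -
    have car: "?L +>\<^bsub>?D\<^esub> f \<in> carrier ?N" using f by (simp add: quot_mod_carrier)
    have "?L +>\<^bsub>?D\<^esub> f \<in> dual_selector R E \<M> i ?N \<longleftrightarrow>
        (\<forall>\<phi>\<in>carrier (dual_mod R E ?N). \<psi> \<phi> \<in> ?I \<longrightarrow> dual_eval R E ?N (?L +>\<^bsub>?D\<^esub> f) \<phi> = \<zero>\<^bsub>E\<^esub>)"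
      unfolding dual_selector_def S
      using car dual_eval_closed[OF E N car] by (auto simp: quot_dual_def[of R E "dual_mod R E ?N"])
    also have "\<dots> \<longleftrightarrow> (\<forall>\<phi>\<in>carrier (dual_mod R E ?N). \<psi> \<phi> \<in> ?I \<longrightarrow> f (\<psi> \<phi>) = \<zero>\<^bsub>E\<^esub>)"
      by (simp add: dual_eval_def \<psi>_eq[OF _ f])
    also have "\<dots> \<longleftrightarrow> (\<forall>c\<in>?I. f c = \<zero>\<^bsub>E\<^esub>)"
      using \<psi>_I by blast
    finally show ?thesis .
  qed
  then show ?thesis
    by (auto simp: residual_closure_def quot_dual_def[of R E B ?I])
qed

section \<open>Membership in the dual class\<close>

lemma mod_iso_id: "(\<lambda>x. x) \<in> mod_iso R M M"
  by (auto simp: mod_iso_def mod_hom_def bij_betw_def)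

text \<open>The quotient of \<open>B\<close> by \<open>C\<close> has an isomorphic copy
  \<open>P\<close> in the class, and dualizing shows \<open>(B/C)\<^sup>\<or>\<close> to be
  isomorphic to the dual of \<open>P\<close>. This provides the class memberships demanded by
  \<open>reductions\<close>.\<close>

lemma quot_dual_in_dual_class:
  assumes E: "module R E" and mod: "\<And>M. M \<in> \<M> \<Longrightarrow> module R M"
    and quot: "closed_under_quotients R \<M>"
    and B: "B \<in> \<M>" and C: "submodule C R B"
  shows "sub_mod (dual_mod R E B) (quot_dual R E B C) \<in> dual_class R E \<M>"
proof -
  note BM = mod[OF B]
  have D: "module R (dual_mod R E B)" by (rule dual_mod_module[OF E BM])
  have L: "submodule (quot_dual R E B C) R (dual_mod R E B)"
    by (rule quot_dual_submodule[OF E BM submoduleD(1)[OF BM C]])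
  have Q: "module R (quot_mod B C)" by (rule quot_mod_module[OF BM C])
  obtain P \<rho> where P: "P \<in> \<M>" "\<rho> \<in> mod_iso R (quot_mod B C) P"
    using quot B C unfolding closed_under_quotients_def by blast
  obtain f where "f \<in> mod_iso R (dual_mod R E P) (sub_mod (dual_mod R E B) (quot_dual R E B C))"
    using mod_iso_comp[OF dual_mod_iso[OF Q mod[OF P(1)] P(2)] dual_quot_mod_iso[OF E BM C]] by blast
  then have "mod_iso R (sub_mod (dual_mod R E B) (quot_dual R E B C)) (dual_mod R E P) \<noteq> {}"
    using mod_iso_inv[OF dual_mod_module[OF E mod[OF P(1)]]] by blast
  then show ?thesis
    using P(1) submodule.submodule_is_module[OF L D] by (auto simp: dual_class_def)
qed

section \<open>The order-reversing correspondence between expansions and reductions\<close>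

theorem theorem6p3:
  fixes R :: "('r, 's) ring_scheme"
    and E :: "('r, 'e) module"
    and \<M> :: "('r, 'm) module set"
    and i :: "('r, 'm) module \<Rightarrow> 'm set"
    and B :: "('r, 'm) module"
    and A :: "'m set"
    and cl :: "('r, 'm \<Rightarrow> 'e) module \<Rightarrow> ('m \<Rightarrow> 'e) set \<Rightarrow> ('m \<Rightarrow> 'e) set"
  assumes "complete_noetherian_local_ring R"
    and "injective_hull R (residue_field_mod R) E"
    and "\<And>M. M \<in> \<M> \<Longrightarrow> matlis_dualizable R E M"
    and "closed_under_submodules R \<M>"
    and "closed_under_quotients R \<M>"
    and "interior_operation R \<M> i"
    and "B \<in> \<M>"
    and "submodule A R B"
    and "matlis_dualizable R E B"
    and "matlis_dualizable R E (sub_mod B A)"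
    and "cl = residual_closure (dual_selector R E \<M> i)"
  shows "bij_betw (quot_dual R E B) (expansions R i B A)
           (reductions R (dual_class R E \<M>) cl (dual_mod R E B) (quot_dual R E B A)) \<and>
         (\<forall>C \<in> expansions R i B A. \<forall>C' \<in> expansions R i B A.
           C \<subseteq> C' \<longleftrightarrow> quot_dual R E B C' \<subseteq> quot_dual R E B C)"
proof -
  let ?D = "dual_mod R E B" and ?N = "dual_class R E \<M> :: ('r, 'm \<Rightarrow> 'e) module set"
  have loc: "local_ring R" and noeth: "noetherian_ring R"
    using assms(1) by (auto simp: complete_noetherian_local_ring_def)
  note hull = assms(2) and dualizable = assms(9)
  have E: "module R E" using hull by (simp add: injective_hull_def injective_mod_def)
  have mod: "module R M" if "M \<in> \<M>" for M by (rule matlis_dualizableD(1)[OF assms(3)[OF that]])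
  note B = mod[OF assms(7)]
  have sel: "submodule_selector R \<M> i"
    using assms(6) by (simp add: interior_operation_def)
  have sub: "sub_mod B C \<in> \<M>" if "submodule C R B" for C
    using assms(4,7) that by (simp add: closed_under_submodules_def)
  \<comment> \<open>The selector gives a submodule of \<open>sub_mod B C\<close>, whose negation is
    formed relative to the carrier \<open>C\<close>. Closure under the negation of \<open>B\<close>
    is therefore obtained through the scalar -1, whose action the two modules share.\<close>
  have iB: "submodule (i (sub_mod B C)) R B" if C: "submodule C R B" for C
  proof -
    have "submodule (i (sub_mod B C)) R (sub_mod B C)"
      using sel sub[OF C] by (simp add: submodule_selector_def)
    note I = submoduleD[OF mod[OF sub[OF C]] this]
    show ?thesis
    proof (rule module.submoduleI[OF B])
      show "i (sub_mod B C) \<subseteq> carrier B" using I(1) submoduleD(1)[OF B C] by simp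
      fix a assume a: "a \<in> i (sub_mod B C)"
      interpret B: module R B by (rule B)
      have "(\<ominus>\<^bsub>R\<^esub> \<one>\<^bsub>R\<^esub>) \<odot>\<^bsub>B\<^esub> a \<in> i (sub_mod B C)"
        using I(5)[of "\<ominus>\<^bsub>R\<^esub> \<one>\<^bsub>R\<^esub>" a] a by simp
      moreover have "a \<in> carrier B" using a I(1) submoduleD(1)[OF B C] by auto
      ultimately show "\<ominus>\<^bsub>B\<^esub> a \<in> i (sub_mod B C)" by (simp add: B.smult_l_minus)
    qed (use I in simp_all)
  qed
  note cl = residual_closure_quot_dual[OF loc noeth hull sel dualizable _ sub, folded assms(11)]
  note le = quot_dual_subset_iff[OF loc noeth hull B]
  have eq: "quot_dual R E B C = quot_dual R E B C' \<longleftrightarrow> C = C'"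
    if "submodule C R B" "submodule C' R B" for C C'
    using le[OF that] le[OF that(2,1)] by blast
  \<comment> \<open>Both closures are again of the form \<open>quot_dual R E B I\<close>, with
    \<open>I\<close> the respective interior. Since \<open>quot_dual R E B\<close> is injective on
    submodules of \<open>B\<close>, the closures agree iff the interiors do.\<close>
  have cl_eq: "cl ?D (quot_dual R E B C) = cl ?D (quot_dual R E B A) \<longleftrightarrow> i (sub_mod B A) = i (sub_mod B C)"
    if "submodule C R B" for C
    using cl[OF that that] cl[OF assms(8,8)] eq[OF iB[OF that] iB[OF assms(8)]] by auto
  have subD: "submodule (quot_dual R E B C) R ?D" if "submodule C R B" for C
    by (rule quot_dual_submodule[OF E B submoduleD(1)[OF B that]])
  have in_class: "sub_mod ?D (quot_dual R E B C) \<in> ?N" if "submodule C R B" for C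
    by (rule quot_dual_in_dual_class[OF E mod assms(5,7) that])
  have D: "module R ?D" by (rule dual_mod_module[OF E B])
  then have DN: "?D \<in> ?N"
    using assms(7) mod_iso_id by (auto simp: dual_class_def)
  \<comment> \<open>The inclusion of \<open>A\<close> in \<open>C\<close> translates to the reversed
    inclusion of the duals, and equality of interiors to equality of closures.\<close>
  have red: "quot_dual R E B C \<in> reductions R ?N cl ?D (quot_dual R E B A) \<longleftrightarrow> C \<in> expansions R i B A"
    if "submodule C R B" for C
    using that cl_eq subD in_class DN le[OF assms(8) that] assms(8)
    by (simp add: reductions_def expansions_def)
  have exp: "submodule C R B" if "C \<in> expansions R i B A" for C
    using that by (simp add: expansions_def)
  have "\<exists>C\<in>expansions R i B A. quot_dual R E B C = L"
    if "L \<in> reductions R ?N cl ?D (quot_dual R E B A)" for L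
  proof -
    have L: "submodule L R ?D" using that by (simp add: reductions_def)
    \<comment> \<open>The preimage of a reduction \<open>L\<close> is its annihilator in
      \<open>B\<close>; \<open>red\<close>, read from right-hand reduction to expansion, shows that
      this annihilator is an expansion of \<open>A\<close>.\<close>
    note C = annihilator_submodule[OF E B submoduleD(1)[OF D L]]
    note L_eq = quot_dual_of_annihilator[OF loc noeth hull dualizable L]
    show ?thesis
      by (rule bexI, rule L_eq) (use red[OF C] that in \<open>simp only: L_eq\<close>)
  qed
  then have "bij_betw (quot_dual R E B) (expansions R i B A)
      (reductions R ?N cl ?D (quot_dual R E B A))"
    using red eq exp unfolding bij_betw_def inj_on_def by blast
  moreover have "\<forall>C \<in> expansions R i B A. \<forall>C' \<in> expansions R i B A.
      C \<subseteq> C' \<longleftrightarrow> quot_dual R E B C' \<subseteq> quot_dual R E B C"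
    using le exp by blast
  ultimately show ?thesis ..
qed

end
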